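(* For all $n\ge1$, the generating function $f_n(x)$ has simple poles at the zeros of $\Psi_{n+1}(x)$.
   Context: A bond-animal on the square lattice is a connected union of bonds (edges), up to translation; it is directed if some root vertex reaches every bond by a path in the animal of north and east steps only. A row is a horizontal strip between lattice lines $y=j$ and $y=j+1$. A 2-directed animal is a directed bond-animal with exactly $2$ vertical bonds in each of its rows; it is primitive if every vertex of degree $1$ lies (horizontally) between vertical bonds. $f_n(x)=\sum_A x^{|A|_h}$, the sum over all primitive 2-directed animals with exactly $2n$ vertical bonds, where $|A|_h$ is the number of horizontal bonds. $\Psi_k(x)$ is the $k$-th cyclotomic polynomial, normalized so that $1-x^m=\prod_{k\mid m}\Psi_k(x)$. *)

theory Defs
  imports
    "HOL-Complex_Analysis.Complex_Analysis"
    "HOL-Computational_Algebra.Polynomial_FPS"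
begin

type_synonym vertex = "int \<times> int"

text \<open>A bond is stored as the ordered pair of its endpoints, oriented east or north, so that a set
  of bonds is at the same time the step relation of the north-east paths inside it.\<close>

type_synonym bond = "vertex \<times> vertex"

definition hbond :: "int \<Rightarrow> int \<Rightarrow> bond" where
  "hbond x y = ((x, y), (x + 1, y))"

definition vbond :: "int \<Rightarrow> int \<Rightarrow> bond" where
  "vbond x y = ((x, y), (x, y + 1))"

definition horizontal_bonds :: "bond set" where
  "horizontal_bonds = {hbond x y | x y. True}"

definition vertical_bonds :: "bond set" where
  "vertical_bonds = {vbond x y | x y. True}"

definition row_bonds :: "int \<Rightarrow> bond set" where
  "row_bonds j = {vbond x j | x. True}"

definition bond_animal :: "bond set \<Rightarrow> bool" where
  "bond_animal A \<longleftrightarrow>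
     A \<subseteq> horizontal_bonds \<union> vertical_bonds \<and> finite A \<and> A \<noteq> {} \<and>
     (\<forall>u\<in>Field A. \<forall>v\<in>Field A. (u, v) \<in> (A \<union> A\<inverse>)\<^sup>*)"

text \<open>A path reaching the bond \<open>(u, v)\<close> is a path to \<open>u\<close> followed by that bond.\<close>

definition directed_animal :: "bond set \<Rightarrow> bool" where
  "directed_animal A \<longleftrightarrow> bond_animal A \<and> (\<exists>r\<in>Field A. \<forall>(u, v)\<in>A. (r, u) \<in> A\<^sup>*)"

definition two_directed_animal :: "bond set \<Rightarrow> bool" where
  "two_directed_animal A \<longleftrightarrow>
     directed_animal A \<and> (\<forall>j. A \<inter> row_bonds j \<noteq> {} \<longrightarrow> card (A \<inter> row_bonds j) = 2)"

definition degree_in :: "bond set \<Rightarrow> vertex \<Rightarrow> nat" where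
  "degree_in A v = card {e \<in> A. fst e = v \<or> snd e = v}"

text \<open>Being between vertical bonds is understood weakly (an endpoint of a vertical bond may qualify)
  and locally: the two bonds lie in one of the two rows bordering the line that contains the
  vertex.\<close>

definition between_vertical_bonds :: "bond set \<Rightarrow> vertex \<Rightarrow> bool" where
  "between_vertical_bonds A v \<longleftrightarrow>
     (\<exists>j\<in>{snd v - 1, snd v}. \<exists>a b. vbond a j \<in> A \<and> vbond b j \<in> A \<and> a \<le> fst v \<and> fst v \<le> b)"

definition primitive_two_directed :: "bond set \<Rightarrow> bool" where
  "primitive_two_directed A \<longleftrightarrow>
     two_directed_animal A \<and> (\<forall>v. degree_in A v = 1 \<longrightarrow> between_vertical_bonds A v)"

definition translate :: "vertex \<Rightarrow> bond set \<Rightarrow> bond set" where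
  "translate t A = (\<lambda>(u, v). (u + t, v + t)) ` A"

definition translation_class :: "bond set \<Rightarrow> bond set set" where
  "translation_class A = range (\<lambda>t. translate t A)"

definition primitive_animals :: "nat \<Rightarrow> nat \<Rightarrow> bond set set set" where
  "primitive_animals n k = translation_class `
     {A. primitive_two_directed A \<and> card (A \<inter> vertical_bonds) = 2 * n \<and>
         card (A \<inter> horizontal_bonds) = k}"

text \<open>The coefficient of \<open>x ^ k\<close> is a genuine count, since \<open>primitive_animals n k\<close> is finite
  (lemma \<open>finite_primitive_animals\<close> below).\<close>

definition primitive_gf :: "nat \<Rightarrow> complex fps" where
  "primitive_gf n = Abs_fps (\<lambda>k. of_nat (card (primitive_animals n k)))"

definition primitive_roots_of_unity :: "nat \<Rightarrow> complex set" where
  "primitive_roots_of_unity k = {z. z ^ k = 1 \<and> (\<forall>j. 0 < j \<and> j < k \<longrightarrow> z ^ j \<noteq> 1)}"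

text \<open>The factors \<open>1 - z x\<close> instead of \<open>x - z\<close> give the normalization in which the first cyclotomic
  polynomial is \<open>1 - x\<close>; for \<open>k \<ge> 2\<close> both products agree. See \<open>prod_cyclotomic\<close>.\<close>

definition cyclotomic :: "nat \<Rightarrow> complex poly" where
  "cyclotomic k = (\<Prod>z\<in>primitive_roots_of_unity k. [:1, -z:])"

text \<open>A simple pole of the rational function that a power series represents. That function does not
  depend on the choice of \<open>p\<close> and \<open>q\<close>.\<close>

definition fps_simple_pole :: "complex fps \<Rightarrow> complex \<Rightarrow> bool" where
  "fps_simple_pole f z \<longleftrightarrow>
     (\<exists>p q. q \<noteq> 0 \<and> fps_of_poly q * f = fps_of_poly p \<and>
            is_pole (\<lambda>w. poly p w / poly q w) z \<and> zorder (\<lambda>w. poly p w / poly q w) z = -1)"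

lemma relpow_bonds_coords:
  assumes "A \<subseteq> horizontal_bonds \<union> vertical_bonds" "(u, v) \<in> A ^^ n"
  shows "fst v \<in> {fst u..fst u + int n} \<and> snd v \<in> {snd u..snd u + int n}"
  using assms(2)
proof (induction n arbitrary: v)
  case 0
  then show ?case by simp
next
  case (Suc n)
  then obtain w where w: "(u, w) \<in> A ^^ n" "(w, v) \<in> A" by auto
  from w(2) assms(1) have "(w, v) \<in> horizontal_bonds \<union> vertical_bonds" by blast
  with Suc.IH[OF w(1)] show ?case
    by (auto simp: horizontal_bonds_def vertical_bonds_def hbond_def vbond_def)
qed

lemma translation_class_translate: "translation_class (translate t A) = translation_class A"
proof -
  have tt: "translate s (translate t A) = translate (t + s) A" for s t
    by (force simp: translate_def image_image case_prod_beta add.assoc)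
  have "translate s A \<in> range (\<lambda>s. translate s (translate t A))" for s
    by (rule range_eqI[of _ _ "s - t"]) (simp add: tt)
  then show ?thesis
    unfolding translation_class_def by (auto simp: tt)
qed

lemma finite_primitive_animals: "finite (primitive_animals n k)"
proof -
  define m where "m = int (2 * n + k)"
  define box :: "vertex set" where "box = {0..m + 1} \<times> {0..m + 1}"
  have "primitive_animals n k \<subseteq> translation_class ` Pow (box \<times> box)"
  proof
    fix C assume "C \<in> primitive_animals n k"
    then obtain A where A: "C = translation_class A" "primitive_two_directed A"
      "card (A \<inter> vertical_bonds) = 2 * n" "card (A \<inter> horizontal_bonds) = k"
      by (auto simp: primitive_animals_def)
    from A(2) have sub: "A \<subseteq> horizontal_bonds \<union> vertical_bonds" and fin: "finite A"
      by (auto simp: primitive_two_directed_def two_directed_animal_def directed_animal_def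
          bond_animal_def)
    from A(2) obtain r where r: "\<forall>(u, v)\<in>A. (r, u) \<in> A\<^sup>*"
      by (auto simp: primitive_two_directed_def two_directed_animal_def directed_animal_def)
    have "A = (A \<inter> vertical_bonds) \<union> (A \<inter> horizontal_bonds)" using sub by blast
    then have "card A \<le> 2 * n + k" using A(3,4) by (metis card_Un_le)
    then have cA: "int (card A) \<le> m" by (simp add: m_def)
    have "translate (- r) A \<subseteq> box \<times> box"
    proof
      fix e assume "e \<in> translate (- r) A"
      then obtain u v where uv: "(u, v) \<in> A" "e = (u - r, v - r)"
        by (auto simp: translate_def)
      from r uv(1) have "(r, u) \<in> A\<^sup>*" by auto
      then obtain i where i: "i \<le> card A" "(r, u) \<in> A ^^ i"
        using rtrancl_finite_eq_relpow[OF fin] by auto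
      have "(u, v) \<in> A ^^ 1" using uv(1) by simp
      from relpow_bonds_coords[OF sub i(2)] relpow_bonds_coords[OF sub this] i(1) cA
      show "e \<in> box \<times> box"
        by (cases u; cases v; cases r) (auto simp: uv(2) box_def)
    qed
    then show "C \<in> translation_class ` Pow (box \<times> box)"
      using A(1) translation_class_translate[of "- r" A] by blast
  qed
  moreover have "finite (translation_class ` Pow (box \<times> box))"
    by (simp add: box_def)
  ultimately show ?thesis by (rule finite_subset)
qed

lemma prod_roots_of_unity:
  assumes "m > 0"
  shows "(\<Prod>z\<in>{z::complex. z ^ m = 1}. [:1, -z:]) = 1 - monom 1 m" (is "?P = ?Q")
proof -
  have fin: "finite {z::complex. z ^ m = 1}" by (rule finite_roots_unity) (use assms in simp)
  have card: "card {z::complex. z ^ m = 1} = m" by (rule card_roots_unity_eq[OF assms])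
  define R where "R = insert 0 {z::complex. z ^ m = 1}"
  have "(0::complex) \<notin> {z. z ^ m = 1}" using assms by (simp add: power_0_left)
  then have cR: "card R = Suc m" unfolding R_def by (rule card_insert_disjoint[OF fin, unfolded card])
  have "degree ?P \<le> (\<Sum>z\<in>{z::complex. z ^ m = 1}. degree [:1, -z:])"
    by (rule degree_prod_sum_le[OF fin, unfolded o_def])
  also have "\<dots> \<le> (\<Sum>z\<in>{z::complex. z ^ m = 1}. 1)" by (intro sum_mono) simp
  finally have dP: "degree ?P \<le> m" using card by simp
  have dQ: "degree ?Q \<le> m"
    by (rule degree_diff_le) (auto simp: degree_monom_le)
  have eq: "poly ?P x = poly ?Q x" if "x \<in> R" for x
  proof (cases "x = 0")
    case True
    then show ?thesis using assms by (simp add: poly_prod poly_monom)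
  next
    case False
    with that have x: "x ^ m = 1" by (simp add: R_def)
    then have "inverse x \<in> {z. z ^ m = 1}" by (simp add: power_inverse)
    moreover have "poly [:1, - inverse x:] x = 0" using False by simp
    ultimately have "poly ?P x = 0" unfolding poly_prod using fin by (intro prod_zero) auto
    then show ?thesis using x by (simp add: poly_monom)
  qed
  have "degree (?P - ?Q) \<le> m" using dP dQ by (rule degree_diff_le)
  moreover have "R \<subseteq> {x. poly (?P - ?Q) x = 0}" using eq by auto
  ultimately have "?P - ?Q = 0"
    using cR card_mono[OF poly_roots_finite, of "?P - ?Q" R] card_poly_roots_bound[of "?P - ?Q"]
    by fastforce
  then show ?thesis by simp
qed

lemma prod_cyclotomic:
  assumes "m > 0"
  shows "(\<Prod>k\<in>{k. k dvd m}. cyclotomic k) = 1 - monom 1 m"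
proof -
  have un: "{z::complex. z ^ m = 1} = (\<Union>k\<in>{k. k dvd m}. primitive_roots_of_unity k)"
  proof (intro equalityI subsetI)
    fix z :: complex assume "z \<in> {z. z ^ m = 1}"
    then have z: "z ^ m = 1" by simp
    define k where "k = (LEAST k. k > 0 \<and> z ^ k = 1)"
    have k: "k > 0 \<and> z ^ k = 1"
      unfolding k_def by (rule LeastI[of _ m]) (use assms z in auto)
    have least: "z ^ j \<noteq> 1" if "0 < j" "j < k" for j
      using not_less_Least[of j "\<lambda>k. k > 0 \<and> z ^ k = 1"] that by (auto simp: k_def)
    have "z ^ m = (z ^ k) ^ (m div k) * z ^ (m mod k)"
      by (metis power_add power_mult mult_div_mod_eq)
    then have "z ^ (m mod k) = 1" using z k by simp
    then have "m mod k = 0" using least[of "m mod k"] k by auto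
    then show "z \<in> (\<Union>k\<in>{k. k dvd m}. primitive_roots_of_unity k)"
      using k least by (auto simp: primitive_roots_of_unity_def)
  qed (auto simp: primitive_roots_of_unity_def power_mult elim!: dvdE)
  have pos: "k > 0" if "k dvd m" for k using that assms by (auto intro: Nat.gr0I)
  have "finite (primitive_roots_of_unity k)" if "k dvd m" for k
  proof (rule finite_subset)
    show "finite {z::complex. z ^ k = 1}"
      by (rule finite_roots_unity) (use pos[OF that] in simp)
  qed (auto simp: primitive_roots_of_unity_def)
  moreover have "primitive_roots_of_unity i \<inter> primitive_roots_of_unity j = {}"
    if "i dvd m" "j dvd m" "i \<noteq> j" for i j
    using pos[OF that(1)] pos[OF that(2)] that(3)
    by (cases i j rule: linorder_cases) (auto simp: primitive_roots_of_unity_def)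
  moreover have "finite {k. k dvd m}" using assms by simp
  ultimately have "(\<Prod>k\<in>{k. k dvd m}. cyclotomic k) = (\<Prod>z\<in>{z::complex. z ^ m = 1}. [:1, -z:])"
    unfolding un cyclotomic_def by (subst prod.UNION_disjoint) auto
  then show ?thesis using prod_roots_of_unity[OF assms] by simp
qed

end

theory Submission
  imports Defs
begin

text \<open>Cut off below a row whose two vertical bonds are at distance \<open>d\<close>, the upper parts of primitive
  animals with \<open>m\<close> further rows have a generating function \<open>h\<^sub>m(d)\<close>, and adding a row is a linear
  operator on functions of \<open>d\<close>. That operator is a combination of multiplication by \<open>x\<^sup>d\<close>, partial
  sums, convolution with \<open>x\<^sup>d\<close>, and tail sums. Hence \<open>h\<^sub>m(d)\<close> is a combination of terms
  \<open>(d choose i) x\<^bsup>jd\<^esup>\<close> with \<open>j \<le> m + 1\<close> whose coefficients have only poles at roots of unity of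
  order at most \<open>m + 1\<close>, and the top exponential \<open>x\<^bsup>(m+1)d\<^esup>\<close> carries no power of \<open>d\<close>. Its
  coefficient is multiplied in each step by
  \<open>u (1 - u (1 + x - x\<^sup>2)) / ((1 - u)\<^sup>2 (1 - x u) (1 - x))\<close> with \<open>u = x\<^bsup>m+1\<^esup>\<close>. On the unit
  circle \<open>|1 + x - x\<^sup>2|\<^sup>2 = 1 + 4 (Im x)\<^sup>2\<close>, so this factor does not vanish at a nonreal root of unity.
  The bottom line sums \<open>x\<^sup>d h\<^sub>m(d)\<close> over \<open>d \<ge> 1\<close>, and for \<open>n = m + 1\<close> rows the top exponential turns
  into \<open>x\<^bsup>n+1\<^esup> / (1 - x\<^bsup>n+1\<^esup>)\<close>, the only source of poles at the primitive roots of order \<open>n + 1\<close>.\<close>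

section \<open>Power series of rational functions regular at a point\<close>

definition fps_value_at :: "complex \<Rightarrow> complex fps \<Rightarrow> complex \<Rightarrow> bool" where
  "fps_value_at z f c \<longleftrightarrow>
     (\<exists>p q. poly q z \<noteq> 0 \<and> fps_of_poly q * f = fps_of_poly p \<and> poly p z = c * poly q z)"

definition fps_regular_at :: "complex \<Rightarrow> complex fps \<Rightarrow> bool" where
  "fps_regular_at z f \<longleftrightarrow> (\<exists>c. fps_value_at z f c)"

lemma fps_value_at_poly: "fps_value_at z (fps_of_poly p) (poly p z)"
  unfolding fps_value_at_def by (rule exI[of _ p], rule exI[of _ 1]) simp

lemma fps_value_at_const: "fps_value_at z (fps_const c) c"
  using fps_value_at_poly[of z "[:c:]"] by (simp add: fps_of_poly_const)

lemma fps_value_at_0: "fps_value_at z 0 0"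
  using fps_value_at_const[of z 0] by simp

lemma fps_value_at_1: "fps_value_at z 1 1"
  using fps_value_at_const[of z 1] by simp

lemma fps_value_at_X: "fps_value_at z fps_X z"
  using fps_value_at_poly[of z "[:0, 1:]"] by (simp add: fps_of_poly_pCons)

lemma fps_value_at_add:
  assumes "fps_value_at z f a" "fps_value_at z g b"
  shows "fps_value_at z (f + g) (a + b)"
proof -
  obtain p q where 1: "poly q z \<noteq> 0" "fps_of_poly q * f = fps_of_poly p" "poly p z = a * poly q z"
    using assms(1) by (auto simp: fps_value_at_def)
  obtain r s where 2: "poly s z \<noteq> 0" "fps_of_poly s * g = fps_of_poly r" "poly r z = b * poly s z"
    using assms(2) by (auto simp: fps_value_at_def)
  have "fps_of_poly (q * s) * (f + g) = fps_of_poly s * (fps_of_poly q * f) + fps_of_poly q * (fps_of_poly s * g)"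
    by (simp add: fps_of_poly_mult algebra_simps)
  also have "\<dots> = fps_of_poly (s * p + q * r)"
    using 1(2) 2(2) by (simp add: fps_of_poly_mult fps_of_poly_add)
  finally show ?thesis
    unfolding fps_value_at_def using 1 2
    by (intro exI[of _ "s * p + q * r"] exI[of _ "q * s"]) (auto simp: algebra_simps)
qed

lemma fps_value_at_mult:
  assumes "fps_value_at z f a" "fps_value_at z g b"
  shows "fps_value_at z (f * g) (a * b)"
proof -
  obtain p q where 1: "poly q z \<noteq> 0" "fps_of_poly q * f = fps_of_poly p" "poly p z = a * poly q z"
    using assms(1) by (auto simp: fps_value_at_def)
  obtain r s where 2: "poly s z \<noteq> 0" "fps_of_poly s * g = fps_of_poly r" "poly r z = b * poly s z"
    using assms(2) by (auto simp: fps_value_at_def)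
  have "fps_of_poly (q * s) * (f * g) = (fps_of_poly q * f) * (fps_of_poly s * g)"
    by (simp add: fps_of_poly_mult algebra_simps)
  also have "\<dots> = fps_of_poly (p * r)"
    using 1(2) 2(2) by (simp add: fps_of_poly_mult)
  finally show ?thesis
    unfolding fps_value_at_def using 1 2
    by (intro exI[of _ "p * r"] exI[of _ "q * s"]) (auto simp: algebra_simps)
qed

lemma fps_value_at_uminus: "fps_value_at z f a \<Longrightarrow> fps_value_at z (- f) (- a)"
  using fps_value_at_mult[OF fps_value_at_const[of z "-1"], of f a] by (simp flip: fps_const_neg)

lemma fps_value_at_diff:
  "fps_value_at z f a \<Longrightarrow> fps_value_at z g b \<Longrightarrow> fps_value_at z (f - g) (a - b)"
  using fps_value_at_add[of z f a "- g" "- b"] fps_value_at_uminus by simp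

lemma fps_value_at_power: "fps_value_at z f a \<Longrightarrow> fps_value_at z (f ^ k) (a ^ k)"
  by (induction k) (auto intro: fps_value_at_1 fps_value_at_mult)

lemma one_minus_X_power_inverse:
  assumes "j > 0"
  shows "(1 - fps_X ^ j) * inverse (1 - fps_X ^ j) = (1 :: complex fps)"
  by (rule inverse_mult_eq_1') (use assms in simp)

lemma fps_value_at_inverse_one_minus_X_power:
  assumes "j > 0" "z ^ j \<noteq> 1"
  shows "fps_value_at z (inverse (1 - fps_X ^ j)) (inverse (1 - z ^ j))"
  unfolding fps_value_at_def
  using assms one_minus_X_power_inverse[OF assms(1)]
  by (intro exI[of _ 1] exI[of _ "1 - monom 1 j"])
    (simp add: fps_of_poly_diff fps_of_poly_monom poly_monom)

lemmas fps_value_at_intros = fps_value_at_0 fps_value_at_1 fps_value_at_X fps_value_at_add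
  fps_value_at_mult fps_value_at_uminus fps_value_at_diff fps_value_at_power
  fps_value_at_inverse_one_minus_X_power

lemma fps_regular_at_0: "fps_regular_at z 0"
  and fps_regular_at_1: "fps_regular_at z 1"
  and fps_regular_at_X: "fps_regular_at z fps_X"
  and fps_regular_at_of_nat: "fps_regular_at z (of_nat k)"
  and fps_regular_at_add: "fps_regular_at z f \<Longrightarrow> fps_regular_at z g \<Longrightarrow> fps_regular_at z (f + g)"
  and fps_regular_at_mult: "fps_regular_at z f \<Longrightarrow> fps_regular_at z g \<Longrightarrow> fps_regular_at z (f * g)"
  and fps_regular_at_uminus: "fps_regular_at z f \<Longrightarrow> fps_regular_at z (- f)"
  and fps_regular_at_diff: "fps_regular_at z f \<Longrightarrow> fps_regular_at z g \<Longrightarrow> fps_regular_at z (f - g)"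
  and fps_regular_at_power: "fps_regular_at z f \<Longrightarrow> fps_regular_at z (f ^ k)"
  and fps_regular_at_inverse_one_minus_X_power:
    "j > 0 \<Longrightarrow> z ^ j \<noteq> 1 \<Longrightarrow> fps_regular_at z (inverse (1 - fps_X ^ j))"
  unfolding fps_regular_at_def
  by (blast intro: fps_value_at_intros fps_value_at_const[of z "of_nat k", unfolded fps_of_nat])+

lemmas fps_regular_at_intros = fps_regular_at_0 fps_regular_at_1 fps_regular_at_X
  fps_regular_at_of_nat fps_regular_at_add fps_regular_at_mult fps_regular_at_uminus
  fps_regular_at_diff fps_regular_at_power fps_regular_at_inverse_one_minus_X_power

section \<open>Exponential polynomials with regular coefficients\<close>

definition binom_exp :: "nat \<Rightarrow> nat \<Rightarrow> nat \<Rightarrow> complex fps" where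
  "binom_exp i j d = of_nat (d choose i) * fps_X ^ (j * d)"

inductive exp_poly :: "complex \<Rightarrow> nat \<Rightarrow> (nat \<Rightarrow> complex fps) \<Rightarrow> bool" for z m where
  base: "j \<le> m \<Longrightarrow> exp_poly z m (binom_exp i j)"
| add: "exp_poly z m f \<Longrightarrow> exp_poly z m g \<Longrightarrow> exp_poly z m (\<lambda>d. f d + g d)"
| scale: "fps_regular_at z c \<Longrightarrow> exp_poly z m f \<Longrightarrow> exp_poly z m (\<lambda>d. c * f d)"

lemma exp_poly_mono: "exp_poly z m f \<Longrightarrow> m \<le> m' \<Longrightarrow> exp_poly z m' f"
  by (induction rule: exp_poly.induct) (auto intro: exp_poly.intros)

lemma exp_poly_exp:
  assumes "fps_regular_at z c" "j \<le> m"
  shows "exp_poly z m (\<lambda>d. c * fps_X ^ (j * d))"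
  using exp_poly.scale[OF assms(1) exp_poly.base[OF assms(2), of z 0]] by (simp add: binom_exp_def)

lemma exp_poly_const: "fps_regular_at z c \<Longrightarrow> exp_poly z m (\<lambda>d. c)"
  using exp_poly_exp[of z c 0 m] by simp

lemma exp_poly_diff:
  assumes "exp_poly z m f" "exp_poly z m g"
  shows "exp_poly z m (\<lambda>d. f d - g d)"
  using exp_poly.add[OF assms(1) exp_poly.scale[OF _ assms(2), of "-1"]]
  by (simp add: fps_regular_at_intros)

lemma exp_poly_regular: "exp_poly z m f \<Longrightarrow> fps_regular_at z (f d)"
  by (induction rule: exp_poly.induct) (auto simp: binom_exp_def intro!: fps_regular_at_intros)

lemma exp_poly_times_exp: "exp_poly z m f \<Longrightarrow> exp_poly z (Suc m) (\<lambda>d. fps_X ^ d * f d)"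
proof (induction rule: exp_poly.induct)
  case (base j i)
  have "(\<lambda>d. fps_X ^ d * binom_exp i j d) = binom_exp i (Suc j)"
    by (auto simp: binom_exp_def power_add mult_ac)
  with base show ?case by (simp add: exp_poly.base)
next
  case (add f g)
  from exp_poly.add[OF add.IH] show ?case by (simp add: distrib_left)
next
  case (scale c f)
  from exp_poly.scale[OF scale.hyps(1) scale.IH] show ?case by (simp add: mult_ac)
qed

lemma binom_exp_Suc:
  "binom_exp (Suc i) j (Suc d) = fps_X ^ j * (binom_exp (Suc i) j d + binom_exp i j d)"
  "binom_exp 0 j (Suc d) = fps_X ^ j * binom_exp 0 j d"
  by (simp_all add: binom_exp_def power_add algebra_simps)

lemma exp_poly_shift: "exp_poly z m f \<Longrightarrow> exp_poly z m (\<lambda>d. f (Suc d))"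
proof (induction rule: exp_poly.induct)
  case (base j i)
  show ?case
    by (cases i) (auto simp: binom_exp_Suc intro!: base exp_poly.intros fps_regular_at_intros)
qed (auto intro: exp_poly.intros)

definition geom_conv :: "nat \<Rightarrow> (nat \<Rightarrow> complex fps) \<Rightarrow> nat \<Rightarrow> complex fps" where
  "geom_conv l h d = (\<Sum>a<d. fps_X ^ (l * a) * h (d - a))"

text \<open>The truncation of the sum at \<open>k\<close> is harmless, since the later terms do not contribute to the
  coefficient of \<open>fps_X ^ k\<close>.\<close>

definition tail_sum :: "(nat \<Rightarrow> complex fps) \<Rightarrow> nat \<Rightarrow> complex fps" where
  "tail_sum h m = Abs_fps (\<lambda>k. \<Sum>e=1..k. (fps_X ^ e * h (m + e)) $ k)"

lemma geom_conv_0: "geom_conv l h 0 = 0"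
  by (simp add: geom_conv_def)

lemma geom_conv_Suc: "geom_conv l h (Suc d) = h (Suc d) + fps_X ^ l * geom_conv l h d"
  by (simp add: geom_conv_def sum.lessThan_Suc_shift sum_distrib_left power_add mult_ac
      del: sum.lessThan_Suc)

lemma geom_conv_eqI:
  assumes "\<And>d. G (Suc d) - fps_X ^ l * G d = h (Suc d)"
  shows "geom_conv l h d = G d - fps_X ^ (l * d) * G 0"
proof (induction d)
  case (Suc d)
  have "G (Suc d) = h (Suc d) + fps_X ^ l * G d" using assms[of d] by (simp add: algebra_simps)
  then show ?case unfolding geom_conv_Suc Suc by (simp add: power_add algebra_simps)
qed (simp add: geom_conv_0)

lemma tail_sum_telescope:
  assumes "\<And>d. g d - fps_X * g (Suc d) = h d"
  shows "tail_sum h m = fps_X * g (Suc m)"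
proof (rule fps_ext)
  fix k
  have *: "(\<Sum>e=1..k. fps_X ^ e * h (m + e)) = fps_X * g (Suc m) - fps_X ^ Suc k * g (m + Suc k)"
    by (induction k) (simp_all flip: assms add: algebra_simps)
  have "tail_sum h m $ k = (\<Sum>e=1..k. fps_X ^ e * h (m + e)) $ k"
    by (simp add: tail_sum_def fps_sum_nth)
  also have "\<dots> = (fps_X * g (Suc m)) $ k"
    unfolding * by (simp add: fps_X_power_mult_nth del: power_Suc)
  finally show "tail_sum h m $ k = (fps_X * g (Suc m)) $ k" .
qed

lemma exp_poly_conv_solve:
  assumes "exp_poly z m f" "l \<le> 1" "l \<le> m" "\<And>j. 0 < j \<Longrightarrow> j \<le> max 1 m \<Longrightarrow> z ^ j \<noteq> 1"
  shows "\<exists>G. exp_poly z m G \<and> (\<forall>d. G (Suc d) - fps_X ^ l * G d = f (Suc d))"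
  using assms(1)
proof (induction rule: exp_poly.induct)
  case (base j i)
  have *: "\<exists>G. exp_poly z m G \<and> (\<forall>d. G (Suc d) - fps_X ^ l * G d = fps_X ^ j * binom_exp i j d)" for i
  proof (cases "j = l")
    case True
    then have "binom_exp (Suc i) j (Suc d) - fps_X ^ l * binom_exp (Suc i) j d =
        fps_X ^ j * binom_exp i j d" for d
      by (simp add: binom_exp_Suc distrib_left)
    then show ?thesis using exp_poly.base[OF base] by blast
  next
    case False
    have "\<exists>c. fps_regular_at z c \<and> c * (fps_X ^ j - fps_X ^ l) = fps_X ^ j"
    proof -
      consider "j = 0" "l = 1" | "l = 0" "j > 0" | "l = 1" "j > 1"
        using False assms(2) by linarith
      then show ?thesis
      proof cases
        case 1
        then show ?thesis using one_minus_X_power_inverse[of 1] assms(4)[of 1]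
            fps_regular_at_inverse_one_minus_X_power[of 1 z]
          by (intro exI[of _ "inverse (1 - fps_X ^ 1)"]) (auto simp: mult.commute)
      next
        case 2
        have "(- (fps_X ^ j * inverse (1 - fps_X ^ j))) * (fps_X ^ j - 1) =
            fps_X ^ j * ((1 - fps_X ^ j :: complex fps) * inverse (1 - fps_X ^ j))"
          by (simp add: algebra_simps)
        then show ?thesis using 2 assms(4)[of j] base one_minus_X_power_inverse[of j]
          by (intro exI[of _ "- (fps_X ^ j * inverse (1 - fps_X ^ j))"])
            (auto intro!: fps_regular_at_intros)
      next
        case 3
        then obtain i where i: "j = Suc i" "i > 0" by (cases j) auto
        have "(- (fps_X ^ i * inverse (1 - fps_X ^ i))) * (fps_X ^ j - fps_X ^ l) =
            fps_X ^ j * ((1 - fps_X ^ i :: complex fps) * inverse (1 - fps_X ^ i))"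
          using i 3 by (simp add: algebra_simps)
        then show ?thesis using 3 i assms(4)[of i] base one_minus_X_power_inverse[of i]
          by (intro exI[of _ "- (fps_X ^ i * inverse (1 - fps_X ^ i))"])
            (auto intro!: fps_regular_at_intros)
      qed
    qed
    then obtain c where c: "fps_regular_at z c" "c * (fps_X ^ j - fps_X ^ l) = fps_X ^ j" by blast
    show ?thesis
    proof (induction i)
      case 0
      have "c * binom_exp 0 j (Suc d) - fps_X ^ l * (c * binom_exp 0 j d) =
          (c * (fps_X ^ j - fps_X ^ l)) * binom_exp 0 j d" for d
        by (simp add: binom_exp_Suc algebra_simps)
      then show ?case unfolding c(2) using c(1) base
        by (intro exI[of _ "\<lambda>d. c * binom_exp 0 j d"]) (auto intro: exp_poly.intros)
    next
      case (Suc i)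
      then obtain G where G: "exp_poly z m G"
        "\<And>d. G (Suc d) - fps_X ^ l * G d = fps_X ^ j * binom_exp i j d" by blast
      let ?G = "\<lambda>d. c * (binom_exp (Suc i) j d - G d)"
      have "?G (Suc d) - fps_X ^ l * ?G d = (c * (fps_X ^ j - fps_X ^ l)) * binom_exp (Suc i) j d" for d
      proof -
        have "?G (Suc d) - fps_X ^ l * ?G d = (c * (fps_X ^ j - fps_X ^ l)) * binom_exp (Suc i) j d
          + c * (fps_X ^ j * binom_exp i j d - (G (Suc d) - fps_X ^ l * G d))"
          by (simp add: binom_exp_Suc algebra_simps)
        then show ?thesis by (simp add: G(2))
      qed
      then show ?case unfolding c(2) using c(1) G(1) base
        by (intro exI[of _ ?G]) (auto intro!: exp_poly.intros exp_poly_diff)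
    qed
  qed
  show ?case
  proof (cases i)
    case 0
    then show ?thesis using *[of 0] by (simp add: binom_exp_Suc)
  next
    case (Suc i')
    obtain G where G: "exp_poly z m G" "\<And>d. G (Suc d) - fps_X ^ l * G d = fps_X ^ j * binom_exp i j d"
      using *[of i] by blast
    obtain G' where G': "exp_poly z m G'" "\<And>d. G' (Suc d) - fps_X ^ l * G' d = fps_X ^ j * binom_exp i' j d"
      using *[of i'] by blast
    have "(G (Suc d) + G' (Suc d)) - fps_X ^ l * (G d + G' d) = binom_exp i j (Suc d)" for d
      using G(2)[of d] G'(2)[of d] by (simp add: Suc binom_exp_Suc algebra_simps)
    then show ?thesis using exp_poly.add[OF G(1) G'(1)] by blast
  qed
next
  case (add f g)
  then obtain F G where F: "exp_poly z m F" "\<And>d. F (Suc d) - fps_X ^ l * F d = f (Suc d)"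
    and G: "exp_poly z m G" "\<And>d. G (Suc d) - fps_X ^ l * G d = g (Suc d)" by blast
  have "(F (Suc d) + G (Suc d)) - fps_X ^ l * (F d + G d) = f (Suc d) + g (Suc d)" for d
    unfolding F(2)[symmetric] G(2)[symmetric] by (simp add: distrib_left)
  then show ?case using exp_poly.add[OF F(1) G(1)] by blast
next
  case (scale c f)
  then obtain F where F: "exp_poly z m F" "\<And>d. F (Suc d) - fps_X ^ l * F d = f (Suc d)" by blast
  have "c * F (Suc d) - fps_X ^ l * (c * F d) = c * f (Suc d)" for d
    unfolding F(2)[symmetric] by (simp add: right_diff_distrib mult.left_commute)
  then show ?case using exp_poly.scale[OF scale.hyps(1) F(1)] by blast
qed

lemma exp_poly_tail_solve:
  assumes "exp_poly z m f" "\<And>j. 0 < j \<Longrightarrow> j \<le> Suc m \<Longrightarrow> z ^ j \<noteq> 1"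
  shows "\<exists>g. exp_poly z m g \<and> (\<forall>d. g d - fps_X * g (Suc d) = f d)"
  using assms(1)
proof (induction rule: exp_poly.induct)
  case (base j i)
  let ?c = "inverse (1 - fps_X ^ Suc j) :: complex fps"
  have c: "fps_regular_at z ?c"
    by (rule fps_regular_at_inverse_one_minus_X_power) (use assms(2)[of "Suc j"] base in auto)
  have c1: "?c * (1 - fps_X ^ Suc j) = 1"
    using one_minus_X_power_inverse[of "Suc j"] by (simp add: mult.commute del: power_Suc)
  show ?case
  proof (induction i)
    case 0
    have "?c * binom_exp 0 j d - fps_X * (?c * binom_exp 0 j (Suc d)) =
        (?c * (1 - fps_X ^ Suc j)) * binom_exp 0 j d" for d
      by (simp add: binom_exp_Suc algebra_simps)
    then show ?case unfolding c1 using c base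
      by (intro exI[of _ "\<lambda>d. ?c * binom_exp 0 j d"]) (auto intro: exp_poly.intros)
  next
    case (Suc i)
    then obtain G where G: "exp_poly z m G"
      "\<And>d. G d - fps_X * G (Suc d) = binom_exp i j d" by blast
    let ?G = "\<lambda>d. ?c * (binom_exp (Suc i) j d + fps_X ^ Suc j * G d)"
    have "?G d - fps_X * ?G (Suc d) = (?c * (1 - fps_X ^ Suc j)) * binom_exp (Suc i) j d" for d
    proof -
      have "?G d - fps_X * ?G (Suc d) = (?c * (1 - fps_X ^ Suc j)) * binom_exp (Suc i) j d
          + ?c * fps_X ^ Suc j * ((G d - fps_X * G (Suc d)) - binom_exp i j d)"
        by (simp add: binom_exp_Suc algebra_simps)
      then show ?thesis by (simp add: G(2))
    qed
    then show ?case unfolding c1 using c G(1) base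
      by (intro exI[of _ ?G]) (auto intro!: exp_poly.intros fps_regular_at_intros simp del: power_Suc)
  qed
next
  case (add f g)
  then obtain F G where F: "exp_poly z m F" "\<And>d. F d - fps_X * F (Suc d) = f d"
    and G: "exp_poly z m G" "\<And>d. G d - fps_X * G (Suc d) = g d" by blast
  have "(F d + G d) - fps_X * (F (Suc d) + G (Suc d)) = f d + g d" for d
    unfolding F(2)[symmetric] G(2)[symmetric] by (simp add: distrib_left)
  then show ?case using exp_poly.add[OF F(1) G(1)] by blast
next
  case (scale c f)
  then obtain F where F: "exp_poly z m F" "\<And>d. F d - fps_X * F (Suc d) = f d" by blast
  have "c * F d - fps_X * (c * F (Suc d)) = c * f d" for d
    unfolding F(2)[symmetric] by (simp add: right_diff_distrib mult.left_commute)
  then show ?case using exp_poly.scale[OF scale.hyps(1) F(1)] by blast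
qed

lemma exp_poly_geom_conv:
  assumes "exp_poly z m f" "l \<le> 1" "l \<le> m" "\<And>j. 0 < j \<Longrightarrow> j \<le> max 1 m \<Longrightarrow> z ^ j \<noteq> 1"
  shows "exp_poly z m (geom_conv l f)"
proof -
  obtain G where G: "exp_poly z m G" "\<And>d. G (Suc d) - fps_X ^ l * G d = f (Suc d)"
    using exp_poly_conv_solve[OF assms] by blast
  have "geom_conv l f = (\<lambda>d. G d - G 0 * fps_X ^ (l * d))"
    using geom_conv_eqI[of G l f, OF G(2)] by (auto simp: mult.commute)
  then show ?thesis
    using G(1) assms(3) by (auto intro!: exp_poly_diff exp_poly_exp exp_poly_regular)
qed

lemma exp_poly_tail_sum:
  assumes "exp_poly z m f" "\<And>j. 0 < j \<Longrightarrow> j \<le> Suc m \<Longrightarrow> z ^ j \<noteq> 1"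
  shows "exp_poly z m (tail_sum f)"
proof -
  obtain g where g: "exp_poly z m g" "\<And>d. g d - fps_X * g (Suc d) = f d"
    using exp_poly_tail_solve[OF assms] by blast
  have "tail_sum f = (\<lambda>m. fps_X * g (Suc m))"
    using tail_sum_telescope[of g f, OF g(2)] by auto
  then show ?thesis
    using g(1) by (auto intro!: exp_poly.scale exp_poly_shift fps_regular_at_intros)
qed

definition leading_term :: "complex \<Rightarrow> nat \<Rightarrow> complex fps \<Rightarrow> (nat \<Rightarrow> complex fps) \<Rightarrow> bool" where
  "leading_term z m c h \<longleftrightarrow> (\<exists>h0. exp_poly z m h0 \<and> h = (\<lambda>d. c * fps_X ^ (Suc m * d) + h0 d))"

lemma leading_term_add:
  assumes "leading_term z m c f" "leading_term z m c' g"
  shows "leading_term z m (c + c') (\<lambda>d. f d + g d)"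
proof -
  obtain f0 where f0: "exp_poly z m f0" "f = (\<lambda>d. c * fps_X ^ (Suc m * d) + f0 d)"
    using assms(1) by (auto simp: leading_term_def)
  obtain g0 where g0: "exp_poly z m g0" "g = (\<lambda>d. c' * fps_X ^ (Suc m * d) + g0 d)"
    using assms(2) by (auto simp: leading_term_def)
  show ?thesis unfolding leading_term_def f0 g0
    by (rule exI[of _ "\<lambda>d. f0 d + g0 d"]) (auto intro: exp_poly.add f0 g0 simp: algebra_simps)
qed

lemma leading_term_scale:
  assumes "leading_term z m c f" "fps_regular_at z r"
  shows "leading_term z m (r * c) (\<lambda>d. r * f d)"
proof -
  obtain f0 where f0: "exp_poly z m f0" "f = (\<lambda>d. c * fps_X ^ (Suc m * d) + f0 d)"
    using assms(1) by (auto simp: leading_term_def)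
  show ?thesis unfolding leading_term_def f0
    by (rule exI[of _ "\<lambda>d. r * f0 d"]) (auto intro: exp_poly.scale f0 assms simp: algebra_simps)
qed

lemma leading_term_exp_poly: "exp_poly z m f \<Longrightarrow> leading_term z m 0 f"
  by (auto simp: leading_term_def)

lemma leading_term_diff:
  assumes "leading_term z m c f" "leading_term z m c' g"
  shows "leading_term z m (c - c') (\<lambda>d. f d - g d)"
  using leading_term_add[OF assms(1) leading_term_scale[OF assms(2), of "-1"]]
  by (simp add: fps_regular_at_intros)

lemma exp_poly_of_leading_term:
  assumes "leading_term z m c h" "fps_regular_at z c"
  shows "exp_poly z (Suc m) h"
proof -
  obtain h0 where h0: "exp_poly z m h0" "h = (\<lambda>d. c * fps_X ^ (Suc m * d) + h0 d)"
    using assms(1) by (auto simp: leading_term_def)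
  show ?thesis unfolding h0(2)
    by (intro exp_poly.add exp_poly_exp assms(2) exp_poly_mono[OF h0(1)]) simp_all
qed

lemma leading_term_times_exp:
  assumes "leading_term z m c h"
  shows "leading_term z (Suc m) c (\<lambda>d. fps_X ^ d * h d)"
proof -
  obtain h0 where h0: "exp_poly z m h0" "h = (\<lambda>d. c * fps_X ^ (Suc m * d) + h0 d)"
    using assms by (auto simp: leading_term_def)
  show ?thesis unfolding leading_term_def h0
    using exp_poly_times_exp[OF h0(1)]
    by (intro exI[of _ "\<lambda>d. fps_X ^ d * h0 d"]) (auto simp: power_add algebra_simps)
qed

lemma geom_conv_add: "geom_conv l (\<lambda>d. f d + g d) d = geom_conv l f d + geom_conv l g d"
  by (simp add: geom_conv_def algebra_simps sum.distrib)

lemma leading_term_sum: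
  assumes "leading_term z m c h" "fps_regular_at z c" "\<And>j. 0 < j \<Longrightarrow> j \<le> Suc m \<Longrightarrow> z ^ j \<noteq> 1"
  shows "leading_term z m (- (fps_X ^ Suc m * inverse (1 - fps_X ^ Suc m)) * c) (geom_conv 0 h)"
proof -
  define \<sigma> :: "complex fps" where "\<sigma> = - (fps_X ^ Suc m * inverse (1 - fps_X ^ Suc m))"
  have \<sigma>: "fps_regular_at z \<sigma>" unfolding \<sigma>_def
    by (intro fps_regular_at_intros) (use assms(3)[of "Suc m"] in auto)
  have \<sigma>1: "\<sigma> * (fps_X ^ Suc m - 1) = fps_X ^ Suc m"
  proof -
    have "\<sigma> * (fps_X ^ Suc m - 1) =
        fps_X ^ Suc m * ((1 - fps_X ^ Suc m) * inverse (1 - fps_X ^ Suc m))"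
      by (simp add: \<sigma>_def algebra_simps)
    then show ?thesis using one_minus_X_power_inverse[of "Suc m"] by (simp del: power_Suc)
  qed
  obtain h0 where h0: "exp_poly z m h0" "h = (\<lambda>d. c * fps_X ^ (Suc m * d) + h0 d)"
    using assms(1) by (auto simp: leading_term_def)
  have "geom_conv 0 (\<lambda>d. c * fps_X ^ (Suc m * d)) d = \<sigma> * c * fps_X ^ (Suc m * d) - \<sigma> * c" for d
  proof -
    have "\<sigma> * c * fps_X ^ (Suc m * Suc d) - fps_X ^ 0 * (\<sigma> * c * fps_X ^ (Suc m * d)) =
        (\<sigma> * (fps_X ^ Suc m - 1)) * (c * fps_X ^ (Suc m * d))" for d
      by (simp add: power_add algebra_simps)
    also have "\<dots> d = c * fps_X ^ (Suc m * Suc d)" for d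
      unfolding \<sigma>1 by (simp add: power_add algebra_simps)
    finally show ?thesis
      using geom_conv_eqI[of "\<lambda>d. \<sigma> * c * fps_X ^ (Suc m * d)" 0 "\<lambda>d. c * fps_X ^ (Suc m * d)" d]
      by simp
  qed
  then have "geom_conv 0 h = (\<lambda>d. \<sigma> * c * fps_X ^ (Suc m * d) + (geom_conv 0 h0 d - \<sigma> * c))"
    unfolding h0(2) geom_conv_add by auto
  moreover have "exp_poly z m (\<lambda>d. geom_conv 0 h0 d - \<sigma> * c)"
    using h0(1) assms(2,3) \<sigma>
    by (intro exp_poly_diff exp_poly_geom_conv exp_poly_const fps_regular_at_intros) auto
  ultimately show ?thesis unfolding leading_term_def \<sigma>_def by blast
qed

lemma leading_term_tail_sum_eq:
  assumes "leading_term z m c h" "\<And>j. 0 < j \<Longrightarrow> j \<le> Suc m \<Longrightarrow> z ^ j \<noteq> 1"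
  obtains h0 where "exp_poly z m h0"
    "\<And>d. tail_sum h d =
      fps_X ^ Suc (Suc m) * inverse (1 - fps_X ^ Suc (Suc m)) * c * fps_X ^ (Suc m * d) + h0 d"
proof -
  define r :: "complex fps" where "r = inverse (1 - fps_X ^ Suc (Suc m))"
  have r: "(1 - fps_X ^ Suc (Suc m)) * r = 1"
    unfolding r_def by (rule one_minus_X_power_inverse) simp
  obtain h0 where h0: "exp_poly z m h0" "h = (\<lambda>d. c * fps_X ^ (Suc m * d) + h0 d)"
    using assms by (auto simp: leading_term_def)
  obtain g0 where g0: "exp_poly z m g0" "\<And>d. g0 d - fps_X * g0 (Suc d) = h0 d"
    using exp_poly_tail_solve[OF h0(1) assms(2)] by blast
  let ?g = "\<lambda>d. r * c * fps_X ^ (Suc m * d) + g0 d"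
  have "?g d - fps_X * ?g (Suc d) = h d" for d
  proof -
    have "?g d - fps_X * ?g (Suc d) =
        ((1 - fps_X ^ Suc (Suc m)) * r) * c * fps_X ^ (Suc m * d) + (g0 d - fps_X * g0 (Suc d))"
      by (simp add: power_add algebra_simps)
    then show ?thesis unfolding r g0(2) h0(2) by simp
  qed
  then have "tail_sum h d = fps_X * ?g (Suc d)" for d by (rule tail_sum_telescope)
  then have "tail_sum h d =
      fps_X ^ Suc (Suc m) * r * c * fps_X ^ (Suc m * d) + fps_X * g0 (Suc d)" for d
    by (simp add: power_add algebra_simps)
  moreover have "exp_poly z m (\<lambda>d. fps_X * g0 (Suc d))"
    by (intro exp_poly.scale exp_poly_shift g0 fps_regular_at_intros)
  ultimately show ?thesis using that unfolding r_def by blast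
qed

lemma leading_term_tail_sum:
  assumes "leading_term z m c h" "\<And>j. 0 < j \<Longrightarrow> j \<le> Suc m \<Longrightarrow> z ^ j \<noteq> 1"
  shows "leading_term z m (fps_X ^ Suc (Suc m) * inverse (1 - fps_X ^ Suc (Suc m)) * c) (tail_sum h)"
  using leading_term_tail_sum_eq[OF assms] unfolding leading_term_def by metis

lemma geom_conv_zero_eq_sum: "geom_conv 0 h d = (\<Sum>a<d. h (d - a))"
  by (simp add: geom_conv_def)

lemma geom_conv_zero_eq_sum_le: "h 0 = 0 \<Longrightarrow> geom_conv 0 h d = (\<Sum>b\<le>d. h b)"
  by (induction d) (simp_all add: geom_conv_0 geom_conv_Suc)

lemma sum_lessThan_eq_geom_conv: "(\<Sum>s<d. h s) = geom_conv 0 h d + h 0 - h d"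
  by (induction d) (simp_all add: geom_conv_0 geom_conv_Suc)

lemma leading_term_sum_lessThan:
  assumes "leading_term z m c h" "fps_regular_at z c" "\<And>j. 0 < j \<Longrightarrow> j \<le> Suc m \<Longrightarrow> z ^ j \<noteq> 1"
  shows "leading_term z m ((- (fps_X ^ Suc m * inverse (1 - fps_X ^ Suc m)) - 1) * c) (\<lambda>d. \<Sum>s<d. h s)"
proof -
  have "fps_regular_at z (h 0)"
    using exp_poly_of_leading_term[OF assms(1,2)] by (rule exp_poly_regular)
  then have "leading_term z m 0 (\<lambda>d. h 0)"
    by (intro leading_term_exp_poly exp_poly_const)
  from leading_term_diff[OF leading_term_add[OF leading_term_sum[OF assms] this] assms(1)]
  show ?thesis unfolding sum_lessThan_eq_geom_conv by (simp add: algebra_simps)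
qed

section \<open>The transfer operator\<close>

definition transfer :: "(nat \<Rightarrow> complex fps) \<Rightarrow> nat \<Rightarrow> complex fps" where
  "transfer h d = (\<Sum>s\<le>d. fps_X ^ s *
     ((\<Sum>b\<in>{b. b \<le> d \<and> (b \<le> s \<or> d \<le> b)}. \<Sum>a\<in>{a. a < b \<and> (a \<le> s \<or> d \<le> a)}. h (b - a)) +
      tail_sum (\<lambda>e. \<Sum>a\<in>{a. a < d + e \<and> (a \<le> s \<or> d \<le> a)}. h (d + e - a)) 0))"

lemma tail_sum_add: "tail_sum (\<lambda>d. f d + g d) m = tail_sum f m + tail_sum g m"
  by (rule fps_ext) (simp add: tail_sum_def distrib_left sum.distrib)

lemma tail_sum_sum: "tail_sum (\<lambda>d. \<Sum>i\<in>I. f i d) m = (\<Sum>i\<in>I. tail_sum (f i) m)"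
proof (rule fps_ext)
  fix k
  have "tail_sum (\<lambda>d. \<Sum>i\<in>I. f i d) m $ k = (\<Sum>e=1..k. \<Sum>i\<in>I. (fps_X ^ e * f i (m + e)) $ k)"
    by (simp add: tail_sum_def sum_distrib_left fps_sum_nth)
  also have "\<dots> = (\<Sum>i\<in>I. \<Sum>e=1..k. (fps_X ^ e * f i (m + e)) $ k)"
    by (rule sum.swap)
  finally show "tail_sum (\<lambda>d. \<Sum>i\<in>I. f i d) m $ k = (\<Sum>i\<in>I. tail_sum (f i) m) $ k"
    by (simp add: tail_sum_def fps_sum_nth)
qed

lemma tail_sum_shift: "tail_sum (\<lambda>e. h (m + e)) 0 = tail_sum h m"
  by (simp add: tail_sum_def)

lemma double_geom_sum:
  assumes "d \<le> D"
  shows "(1 - fps_X) * (\<Sum>s<D. fps_X ^ s * (\<Sum>a\<in>{a. a \<le> s \<and> a < d}. g (d - a))) =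
    geom_conv 1 g d - fps_X ^ D * geom_conv 0 g d"
proof -
  have geo: "(1 - fps_X) * (\<Sum>s\<in>{a..<D}. fps_X ^ s) = (fps_X ^ a - fps_X ^ D :: complex fps)"
    if "a \<le> D" for a
    using that
  proof (induction D rule: dec_induct)
    case (step D)
    then show ?case
      by (simp only: sum.atLeastLessThan_Suc distrib_left) (simp add: algebra_simps)
  qed simp
  have "(\<Sum>s<D. fps_X ^ s * (\<Sum>a\<in>{a. a \<le> s \<and> a < d}. g (d - a))) =
      (\<Sum>s<D. \<Sum>a\<in>{a. a \<in> {..<d} \<and> a \<le> s}. fps_X ^ s * g (d - a))"
    by (intro sum.cong) (auto simp: sum_distrib_left intro!: sum.cong)
  also have "\<dots> = (\<Sum>a<d. \<Sum>s\<in>{s. s \<in> {..<D} \<and> a \<le> s}. fps_X ^ s * g (d - a))"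
    by (rule sum.swap_restrict) auto
  also have "\<dots> = (\<Sum>a<d. (\<Sum>s\<in>{a..<D}. fps_X ^ s) * g (d - a))"
    by (intro sum.cong) (auto simp: sum_distrib_right intro!: sum.cong)
  finally have "(1 - fps_X) * (\<Sum>s<D. fps_X ^ s * (\<Sum>a\<in>{a. a \<le> s \<and> a < d}. g (d - a))) =
      (\<Sum>a<d. ((1 - fps_X) * (\<Sum>s\<in>{a..<D}. fps_X ^ s)) * g (d - a))"
    by (simp add: sum_distrib_left[of _ _ "{..<d}"] mult.assoc)
  also have "\<dots> = (\<Sum>a<d. (fps_X ^ a - fps_X ^ D) * g (d - a))"
    using assms by (intro sum.cong) (auto simp: geo)
  also have "\<dots> = geom_conv 1 g d - fps_X ^ D * geom_conv 0 g d"
    by (simp add: geom_conv_def left_diff_distrib sum_subtractf sum_distrib_left)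
  finally show ?thesis .
qed

lemma one_minus_X_inverse: "(1 - fps_X) * inverse (1 - fps_X) = (1 :: complex fps)"
  using one_minus_X_power_inverse[of 1] by simp

lemma eq_inverse_one_minus_X_mult:
  fixes f g :: "complex fps"
  assumes "(1 - fps_X) * f = g"
  shows "f = inverse (1 - fps_X) * g"
proof -
  have "inverse (1 - fps_X) * g = ((1 - fps_X) * inverse (1 - fps_X)) * f"
    unfolding assms[symmetric] by (simp only: mult_ac)
  then show ?thesis by (simp only: one_minus_X_inverse mult_1)
qed

lemma double_geom_sum_eq:
  assumes "d \<le> D"
  shows "(\<Sum>s<D. fps_X ^ s * (\<Sum>a\<in>{a. a \<le> s \<and> a < d}. g (d - a))) =
    inverse (1 - fps_X) * (geom_conv 1 g d - fps_X ^ D * geom_conv 0 g d)"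
  by (rule eq_inverse_one_minus_X_mult) (rule double_geom_sum[OF assms])

lemma sum_power_le_eq: "(\<Sum>s\<le>d. fps_X ^ s) = inverse (1 - fps_X) * (1 - fps_X ^ Suc d :: complex fps)"
proof -
  have "(1 - fps_X) * (\<Sum>s\<le>d. fps_X ^ s) = (1 - fps_X ^ Suc d :: complex fps)"
  proof (induction d)
    case (Suc d)
    then show ?case by (simp only: sum.atMost_Suc distrib_left) (simp add: algebra_simps)
  qed simp
  then show ?thesis by (rule eq_inverse_one_minus_X_mult)
qed

lemma transfer_eq:
  "transfer h d =
    fps_X ^ d * geom_conv 0 (geom_conv 0 h) d +
    (\<Sum>s<d. fps_X ^ s * geom_conv 0 (geom_conv 0 h) s) +
    inverse (1 - fps_X) * (geom_conv 1 h d - fps_X ^ d * geom_conv 0 h d) +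
    inverse (1 - fps_X) * (geom_conv 1 (tail_sum h) d - fps_X * (fps_X ^ d * geom_conv 0 (tail_sum h) d)) +
    tail_sum (geom_conv 0 h) 0 * (inverse (1 - fps_X) * (1 - fps_X ^ Suc d))"
proof -
  let ?SS = "geom_conv 0 (geom_conv 0 h)"
  let ?c = "\<lambda>s. \<Sum>b\<in>{b. b \<le> d \<and> (b \<le> s \<or> d \<le> b)}. \<Sum>a\<in>{a. a < b \<and> (a \<le> s \<or> d \<le> a)}. h (b - a)"
  let ?t = "\<lambda>s. tail_sum (\<lambda>e. \<Sum>a\<in>{a. a < d + e \<and> (a \<le> s \<or> d \<le> a)}. h (d + e - a)) 0"
  let ?A = "\<lambda>s. {a. a \<le> s \<and> a < d}"
  have SS: "?SS s = (\<Sum>b\<le>s. \<Sum>a<b. h (b - a))" for s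
    by (simp add: geom_conv_zero_eq_sum_le geom_conv_0) (simp add: geom_conv_zero_eq_sum)
  have c1: "?c s = ?SS s + (\<Sum>a\<in>?A s. h (d - a))" if "s < d" for s
  proof -
    have "{b. b \<le> d \<and> (b \<le> s \<or> d \<le> b)} = insert d {..s}" using that by auto
    then have "?c s = (\<Sum>a\<in>{a. a < d \<and> (a \<le> s \<or> d \<le> a)}. h (d - a)) +
        (\<Sum>b\<le>s. \<Sum>a\<in>{a. a < b \<and> (a \<le> s \<or> d \<le> a)}. h (b - a))"
      using that by simp
    also have "{a. a < d \<and> (a \<le> s \<or> d \<le> a)} = ?A s" by auto
    also have "(\<Sum>b\<le>s. \<Sum>a\<in>{a. a < b \<and> (a \<le> s \<or> d \<le> a)}. h (b - a)) = ?SS s"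
      unfolding SS by (intro sum.cong) auto
    finally show ?thesis by simp
  qed
  have c2: "?c d = ?SS d"
    unfolding SS by (intro sum.cong) auto
  have t: "?t s = (\<Sum>a\<in>?A s. tail_sum h (d - a)) + tail_sum (geom_conv 0 h) 0" for s
  proof -
    have *: "(\<Sum>a\<in>{a. a < d + e \<and> (a \<le> s \<or> d \<le> a)}. h (d + e - a)) =
        (\<Sum>a\<in>?A s. h (d - a + e)) + geom_conv 0 h e" for e
    proof -
      have un: "{a. a < d + e \<and> (a \<le> s \<or> d \<le> a)} = ?A s \<union> {d..<d + e}" by auto
      have "(\<Sum>a\<in>{a. a < d + e \<and> (a \<le> s \<or> d \<le> a)}. h (d + e - a)) =
          (\<Sum>a\<in>?A s. h (d + e - a)) + (\<Sum>a\<in>{d..<d + e}. h (d + e - a))"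
        unfolding un by (rule sum.union_disjoint) auto
      also have "(\<Sum>a\<in>{d..<d + e}. h (d + e - a)) = geom_conv 0 h e"
        unfolding geom_conv_zero_eq_sum
        by (rule sum.reindex_bij_witness[of _ "\<lambda>a. a + d" "\<lambda>a. a - d"]) (auto simp: add.commute)
      also have "(\<Sum>a\<in>?A s. h (d + e - a)) = (\<Sum>a\<in>?A s. h (d - a + e))"
        by (intro sum.cong) auto
      finally show ?thesis .
    qed
    show ?thesis unfolding * tail_sum_add tail_sum_sum tail_sum_shift ..
  qed
  have "transfer h d = (\<Sum>s\<le>d. fps_X ^ s * ?c s) + (\<Sum>s\<le>d. fps_X ^ s * ?t s)"
    by (simp add: transfer_def distrib_left sum.distrib)
  also have "(\<Sum>s\<le>d. fps_X ^ s * ?c s) = fps_X ^ d * ?SS d +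
      (\<Sum>s<d. fps_X ^ s * (?SS s + (\<Sum>a\<in>?A s. h (d - a))))"
    using c1 c2 by (simp flip: lessThan_Suc_atMost)
  also have "\<dots> = fps_X ^ d * ?SS d + (\<Sum>s<d. fps_X ^ s * ?SS s) +
      (\<Sum>s<d. fps_X ^ s * (\<Sum>a\<in>?A s. h (d - a)))"
    by (simp add: distrib_left sum.distrib)
  also have "(\<Sum>s<d. fps_X ^ s * (\<Sum>a\<in>?A s. h (d - a))) =
      inverse (1 - fps_X) * (geom_conv 1 h d - fps_X ^ d * geom_conv 0 h d)"
    by (rule double_geom_sum_eq) simp
  also have "(\<Sum>s\<le>d. fps_X ^ s * ?t s) =
      (\<Sum>s<Suc d. fps_X ^ s * (\<Sum>a\<in>?A s. tail_sum h (d - a))) +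
      tail_sum (geom_conv 0 h) 0 * (\<Sum>s\<le>d. fps_X ^ s)"
    unfolding t lessThan_Suc_atMost
    by (simp add: distrib_left sum.distrib sum_distrib_right
        mult.commute[of "tail_sum (geom_conv 0 h) 0"])
  also have "(\<Sum>s<Suc d. fps_X ^ s * (\<Sum>a\<in>?A s. tail_sum h (d - a))) =
      inverse (1 - fps_X) * (geom_conv 1 (tail_sum h) d - fps_X * (fps_X ^ d * geom_conv 0 (tail_sum h) d))"
    by (subst double_geom_sum_eq) (simp_all add: mult.assoc)
  also note sum_power_le_eq
  finally show ?thesis by (simp add: add.assoc)
qed

lemma leading_term_transfer:
  assumes h: "leading_term z m c h" and c: "fps_value_at z c c0" "c0 \<noteq> 0"
    and "z \<noteq> 0"
    and z: "\<And>j. 0 < j \<Longrightarrow> j \<le> Suc (Suc m) \<Longrightarrow> z ^ j \<noteq> 1" "z ^ Suc m * (1 + z - z\<^sup>2) \<noteq> 1"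
  shows "\<exists>c' c0'. leading_term z (Suc m) c' (transfer h) \<and> fps_value_at z c' c0' \<and> c0' \<noteq> 0"
proof -
  define r where "r = (\<lambda>j. fps_X ^ j * inverse (1 - fps_X ^ j) :: complex fps)"
  define i where "i = inverse (1 - fps_X :: complex fps)"
  let ?N = "tail_sum h"
  have r_val: "fps_value_at z (r j) (z ^ j / (1 - z ^ j))" if "0 < j" "j \<le> Suc (Suc m)" for j
    using fps_value_at_mult[OF fps_value_at_power[OF fps_value_at_X]
        fps_value_at_inverse_one_minus_X_power[OF that(1) z(1)[OF that]]]
    by (simp add: r_def divide_inverse)
  have i_val: "fps_value_at z i (1 / (1 - z))"
    using fps_value_at_inverse_one_minus_X_power[of 1 z] z(1)[of 1]
    by (simp add: i_def divide_inverse)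
  have reg: "fps_regular_at z c" "fps_regular_at z (r (Suc m))" "fps_regular_at z (r (Suc (Suc m)))"
    "fps_regular_at z i"
    using c(1) r_val[of "Suc m"] r_val[of "Suc (Suc m)"] i_val by (auto simp: fps_regular_at_def)
  note reg' = reg fps_regular_at_mult fps_regular_at_uminus fps_regular_at_X
  have z': "z ^ j \<noteq> 1" if "0 < j" "j \<le> Suc m" for j using z(1) that by simp
  have z'': "z ^ j \<noteq> 1" if "0 < j" "j \<le> max 1 (Suc m)" for j using z(1) that by simp
  have S: "leading_term z m (- r (Suc m) * a) (geom_conv 0 f)"
    if "leading_term z m a f" "fps_regular_at z a" for a f
    unfolding r_def by (rule leading_term_sum[OF that z'])
  have N: "leading_term z m (r (Suc (Suc m)) * c) ?N"
    unfolding r_def by (rule leading_term_tail_sum[OF h z'])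
  have hE: "exp_poly z (Suc m) h" by (rule exp_poly_of_leading_term[OF h reg(1)])
  have NE: "exp_poly z (Suc m) ?N" by (rule exp_poly_of_leading_term[OF N]) (intro reg')
  have Sh: "leading_term z m (- r (Suc m) * c) (geom_conv 0 h)" by (rule S[OF h reg(1)])
  have SN: "leading_term z m (- r (Suc m) * (r (Suc (Suc m)) * c)) (geom_conv 0 ?N)"
    by (rule S[OF N]) (intro reg')
  have "leading_term z m (- r (Suc m) * (- r (Suc m) * c)) (geom_conv 0 (geom_conv 0 h))"
    by (rule S[OF Sh]) (intro reg')
  note T1 = leading_term_times_exp[OF this]
  have T2: "leading_term z (Suc m) ((- r (Suc (Suc m)) - 1) * (- r (Suc m) * (- r (Suc m) * c)))
      (\<lambda>d. \<Sum>s<d. fps_X ^ s * geom_conv 0 (geom_conv 0 h) s)"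
    unfolding r_def
    by (rule leading_term_sum_lessThan[OF T1[unfolded r_def] _ z(1)]) (intro reg'[unfolded r_def])
  have K: "leading_term z (Suc m) 0 (geom_conv 1 f)" if "exp_poly z (Suc m) f" for f
    by (intro leading_term_exp_poly exp_poly_geom_conv that z'') auto
  note T3 = leading_term_scale[OF leading_term_diff[OF K[OF hE] leading_term_times_exp[OF Sh]] reg(4)]
  note T4 = leading_term_scale[OF leading_term_diff[OF K[OF NE]
        leading_term_scale[OF leading_term_times_exp[OF SN] fps_regular_at_X]] reg(4)]
  have "exp_poly z (Suc m) (tail_sum (geom_conv 0 h))"
    by (intro exp_poly_tail_sum exp_poly_of_leading_term[OF Sh] reg') (rule z(1))
  then have L: "fps_regular_at z (tail_sum (geom_conv 0 h) 0)" by (rule exp_poly_regular)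
  have "exp_poly z (Suc m) (\<lambda>d. 1 - fps_X * fps_X ^ (1 * d))"
    by (intro exp_poly_diff exp_poly_const exp_poly_exp fps_regular_at_intros) auto
  then have T5: "leading_term z (Suc m) 0
      (\<lambda>d. tail_sum (geom_conv 0 h) 0 * (i * (1 - fps_X ^ Suc d)))"
    by (intro leading_term_exp_poly exp_poly.scale L reg) simp
  define c' where "c' = - r (Suc m) * (- r (Suc m) * c) +
      (- r (Suc (Suc m)) - 1) * (- r (Suc m) * (- r (Suc m) * c)) +
      i * (0 - - r (Suc m) * c) + i * (0 - fps_X * (- r (Suc m) * (r (Suc (Suc m)) * c))) + 0"
  have "leading_term z (Suc m) c' (transfer h)"
    using leading_term_add[OF leading_term_add[OF leading_term_add[OF leading_term_add[OF T1 T2] T3] T4] T5]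
    unfolding c'_def transfer_eq[abs_def] i_def .
  moreover define u where "u = z ^ Suc m"
  define \<sigma> where "\<sigma> = u / (1 - u)"
  define \<tau> where "\<tau> = z * u / (1 - z * u)"
  define c0' where "c0' = - \<sigma> * (- \<sigma> * c0) + (- \<tau> - 1) * (- \<sigma> * (- \<sigma> * c0)) +
      1 / (1 - z) * (0 - - \<sigma> * c0) + 1 / (1 - z) * (0 - z * (- \<sigma> * (\<tau> * c0))) + 0"
  have "fps_value_at z (r (Suc m)) \<sigma>" "fps_value_at z (r (Suc (Suc m))) \<tau>"
    using r_val[of "Suc m"] r_val[of "Suc (Suc m)"] by (simp_all add: \<sigma>_def \<tau>_def u_def)
  then have "fps_value_at z c' c0'"
    unfolding c'_def c0'_def by (intro fps_value_at_intros i_val c(1)) auto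
  moreover have "c0' \<noteq> 0"
  proof -
    have nz: "1 - u \<noteq> 0" "1 - z * u \<noteq> 0" "1 - z \<noteq> 0" "u \<noteq> 0"
      using z(1)[of "Suc m"] z(1)[of "Suc (Suc m)"] z(1)[of 1] \<open>z \<noteq> 0\<close> by (auto simp: u_def)
    have "c0' * ((1 - u)\<^sup>2 * (1 - z * u) * (1 - z)) = c0 * u * (1 - u * (1 + z - z\<^sup>2))"
      using nz unfolding c0'_def \<sigma>_def \<tau>_def by (simp add: divide_simps) algebra
    moreover have "c0 * u * (1 - u * (1 + z - z\<^sup>2)) \<noteq> 0"
      using c(2) nz z(2) by (auto simp: u_def)
    ultimately show ?thesis by auto
  qed
  ultimately show ?thesis by blast
qed

fun upper_gf :: "nat \<Rightarrow> nat \<Rightarrow> complex fps" where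
  "upper_gf 0 d = (\<Sum>s\<le>d. fps_X ^ s)"
| "upper_gf (Suc m) d = transfer (upper_gf m) d"

lemma unit_circle_factor_neq_1:
  fixes z :: complex
  assumes "norm z = 1" "z\<^sup>2 \<noteq> 1"
  shows "z ^ k * (1 + z - z\<^sup>2) \<noteq> 1"
proof
  assume "z ^ k * (1 + z - z\<^sup>2) = 1"
  then have "norm (z ^ k * (1 + z - z\<^sup>2)) = norm (1 :: complex)" by simp
  then have "norm (1 + z - z\<^sup>2) = 1" using assms(1) by (simp add: norm_mult norm_power)
  moreover have "z * cnj z = 1" using complex_norm_square[of z] assms(1) by simp
  then have "1 + z - z\<^sup>2 = z * (1 + (cnj z - z))" by (simp add: power2_eq_square algebra_simps)
  ultimately have "norm (1 + (cnj z - z)) = 1" using assms(1) by (simp add: norm_mult)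
  then have "(Re (1 + (cnj z - z)))\<^sup>2 + (Im (1 + (cnj z - z)))\<^sup>2 = 1"
    by (simp add: cmod_def)
  then have "Im z = 0" by simp
  then have "z = cnj z" by (simp add: complex_eq_iff)
  with \<open>z * cnj z = 1\<close> have "z\<^sup>2 = 1" by (simp add: power2_eq_square)
  with assms(2) show False by simp
qed

lemma leading_term_upper_gf:
  assumes "norm z = 1" "\<And>j. 0 < j \<Longrightarrow> j \<le> Suc m \<Longrightarrow> z ^ j \<noteq> 1"
  shows "\<exists>c c0. leading_term z m c (upper_gf m) \<and> fps_value_at z c c0 \<and> c0 \<noteq> 0"
  using assms(2)
proof (induction m)
  case 0
  let ?i = "inverse (1 - fps_X) :: complex fps"
  have i: "fps_value_at z ?i (inverse (1 - z))"
    using fps_value_at_inverse_one_minus_X_power[of 1 z] 0[of 1] by simp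
  have "upper_gf 0 = (\<lambda>d. - (?i * fps_X) * fps_X ^ (Suc 0 * d) + ?i)"
    by (rule ext) (simp add: sum_power_le_eq algebra_simps)
  moreover have "exp_poly z 0 (\<lambda>d. ?i)"
    by (rule exp_poly_const) (use i in \<open>auto simp: fps_regular_at_def\<close>)
  ultimately have "leading_term z 0 (- (?i * fps_X)) (upper_gf 0)"
    unfolding leading_term_def by blast
  moreover have "fps_value_at z (- (?i * fps_X)) (- (inverse (1 - z) * z))"
    by (intro fps_value_at_uminus fps_value_at_mult i fps_value_at_X)
  moreover have "- (inverse (1 - z) * z) \<noteq> 0" using 0[of 1] assms(1) by auto
  ultimately show ?case by blast
next
  case (Suc m)
  then obtain c c0 where "leading_term z m c (upper_gf m)" "fps_value_at z c c0" "c0 \<noteq> 0"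
    by fastforce
  moreover have "z ^ Suc m * (1 + z - z\<^sup>2) \<noteq> 1"
    using unit_circle_factor_neq_1[OF assms(1)] Suc.prems[of 2] by (simp del: power_Suc)
  moreover have "z \<noteq> 0" using assms(1) by auto
  moreover have "upper_gf (Suc m) = transfer (upper_gf m)" by (rule ext) simp
  ultimately show ?case
    using leading_term_transfer[of z m c "upper_gf m" c0] Suc.prems by simp
qed

lemma quotient_simple_pole:
  fixes p q :: "complex poly"
  assumes "poly p z \<noteq> 0" "poly q z \<noteq> 0"
  shows "is_pole (\<lambda>w. poly p w / poly ([:- z, 1:] * q) w) z"
    and "zorder (\<lambda>w. poly p w / poly ([:- z, 1:] * q) w) z = -1"
proof -
  let ?g = "\<lambda>w. poly p w / poly q w"
  have eq: "(\<lambda>w. poly p w / poly ([:- z, 1:] * q) w) = (\<lambda>w. ?g w / (w - z))"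
    by (auto simp: field_simps)
  have "filterlim (\<lambda>w. w - z) (at 0) (at z)"
    by (rule filterlim_atI) (auto intro!: tendsto_eq_intros simp: eventually_at_filter)
  moreover have "isCont ?g z" using assms(2) by (intro continuous_intros) auto
  ultimately show "is_pole (\<lambda>w. poly p w / poly ([:- z, 1:] * q) w) z"
    unfolding eq using assms by (intro is_pole_divide) auto
  have "open {w. poly q w \<noteq> 0}"
    by (intro open_Collect_neq continuous_intros)
  moreover have "?g holomorphic_on {w. poly q w \<noteq> 0}"
    by (intro holomorphic_intros) auto
  ultimately show "zorder (\<lambda>w. poly p w / poly ([:- z, 1:] * q) w) z = -1"
    unfolding eq using assms
    by (intro zorder_eqI[of "{w. poly q w \<noteq> 0}" z ?g]) (auto simp: divide_inverse)
qed

lemma one_minus_monom_factor: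
  fixes z :: complex
  assumes "z ^ k = 1" "k > 0"
  obtains t where "1 - monom 1 k = [:- z, 1:] * t" "poly t z \<noteq> 0"
proof -
  have "poly (1 - monom 1 k) z = 0" using assms by (simp add: poly_monom)
  then have "[:- z, 1:] dvd 1 - monom 1 k" by (simp only: poly_eq_0_iff_dvd)
  then obtain t where t: "1 - monom 1 k = [:- z, 1:] * t" by (rule dvdE)
  have "pderiv (1 - monom 1 k) = [:- z, 1:] * pderiv t + t"
    by (simp only: t pderiv_mult) (simp add: pderiv_pCons)
  then have "poly (pderiv (1 - monom 1 k)) z = poly t z" by simp
  moreover have "poly (pderiv (1 - monom 1 k)) z = - of_nat k * z ^ (k - 1)"
    by (simp add: pderiv_diff pderiv_monom poly_monom)
  moreover have "z \<noteq> 0" using assms by (auto simp: power_0_left)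
  ultimately have "poly t z \<noteq> 0" using assms by auto
  with t that show ?thesis by blast
qed

lemma simple_pole_tail_sum:
  assumes h: "leading_term z m c h" and c: "fps_value_at z c c0" "c0 \<noteq> 0"
    and z: "\<And>j. 0 < j \<Longrightarrow> j \<le> Suc m \<Longrightarrow> z ^ j \<noteq> 1" "z ^ Suc (Suc m) = 1"
  shows "fps_simple_pole (tail_sum h 0) z"
proof -
  define k where "k = Suc (Suc m)"
  have zk: "z ^ k = 1" using z(2) by (simp add: k_def)
  obtain h0 where h0: "exp_poly z m h0"
    "\<And>d. tail_sum h d = fps_X ^ k * inverse (1 - fps_X ^ k) * c * fps_X ^ (Suc m * d) + h0 d"
    using leading_term_tail_sum_eq[OF h z(1)] unfolding k_def by blast
  obtain r where r: "fps_value_at z (h0 0) r"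
    using exp_poly_regular[OF h0(1)] by (auto simp: fps_regular_at_def)
  have "(1 - fps_X ^ k) * tail_sum h 0 =
      ((1 - fps_X ^ k) * inverse (1 - fps_X ^ k)) * (fps_X ^ k * c) + (1 - fps_X ^ k) * h0 0"
    by (simp add: h0(2) algebra_simps)
  also have "\<dots> = fps_X ^ k * c + (1 - fps_X ^ k) * h0 0"
    by (subst one_minus_X_power_inverse) (simp_all add: k_def)
  finally have eq: "(1 - fps_X ^ k) * tail_sum h 0 = fps_X ^ k * c + (1 - fps_X ^ k) * h0 0" .
  have "fps_value_at z (fps_X ^ k * c + (1 - fps_X ^ k) * h0 0) (z ^ k * c0 + (1 - z ^ k) * r)"
    by (intro fps_value_at_intros c(1) r)
  then obtain p q where pq: "poly q z \<noteq> 0" "poly p z = c0 * poly q z"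
    "fps_of_poly q * ((1 - fps_X ^ k) * tail_sum h 0) = fps_of_poly p"
    unfolding eq fps_value_at_def using zk by auto
  obtain t where t: "1 - monom 1 k = [:- z, 1:] * t" "poly t z \<noteq> 0"
    using one_minus_monom_factor[OF zk] by (auto simp: k_def)
  have "fps_of_poly ([:- z, 1:] * (t * q)) = fps_of_poly ((1 - monom 1 k) * q)"
    unfolding t(1) by (simp only: mult.assoc)
  also have "\<dots> = (1 - fps_X ^ k) * fps_of_poly q"
    by (simp add: fps_of_poly_mult fps_of_poly_diff fps_of_poly_monom)
  finally have Q: "fps_of_poly ([:- z, 1:] * (t * q)) = (1 - fps_X ^ k) * fps_of_poly q" .
  have "fps_of_poly ([:- z, 1:] * (t * q)) * tail_sum h 0 = fps_of_poly p"
    unfolding Q using pq(3) by (simp only: mult_ac)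
  moreover have "poly p z \<noteq> 0" "poly (t * q) z \<noteq> 0" using pq c(2) t(2) by auto
  moreover from this(2) have "[:- z, 1:] * (t * q) \<noteq> 0"
    by (metis mult_eq_0_iff pCons_eq_0_iff one_neq_zero poly_0)
  ultimately show ?thesis
    unfolding fps_simple_pole_def using quotient_simple_pole[of p z "t * q"] by blast
qed

lemma primitive_root_of_cyclotomic_zero:
  assumes "k \<ge> 1" "poly (cyclotomic k) z = 0"
  shows "z \<in> primitive_roots_of_unity k"
proof -
  have "finite (primitive_roots_of_unity k)"
    by (rule finite_subset[OF _ finite_roots_unity[of k]])
      (use assms(1) in \<open>auto simp: primitive_roots_of_unity_def\<close>)
  then obtain w where w: "w \<in> primitive_roots_of_unity k" "z * w = 1"
    using assms(2) by (auto simp: cyclotomic_def poly_prod mult.commute)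
  have "z ^ j * w ^ j = 1" for j using w(2) by (metis power_mult_distrib power_one)
  then have "z ^ j = 1 \<longleftrightarrow> w ^ j = 1" for j by (metis mult_1 mult_1_right)
  with w(1) show ?thesis by (simp add: primitive_roots_of_unity_def)
qed

lemma simple_pole_upper_gf:
  assumes "poly (cyclotomic (Suc (Suc m))) z = 0"
  shows "fps_simple_pole (tail_sum (upper_gf m) 0) z"
proof -
  have "z \<in> primitive_roots_of_unity (Suc (Suc m))"
    using assms by (intro primitive_root_of_cyclotomic_zero) auto
  then have z: "z ^ Suc (Suc m) = 1" "\<And>j. 0 < j \<Longrightarrow> j \<le> Suc m \<Longrightarrow> z ^ j \<noteq> 1"
    by (auto simp: primitive_roots_of_unity_def)
  then have "norm z = 1" using power_eq_1_iff[OF z(1)] by simp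
  then show ?thesis
    using leading_term_upper_gf[OF _ z(2)] simple_pole_tail_sum[OF _ _ _ z(2,1)] by blast
qed

section \<open>Codes of animals\<close>

text \<open>The part of an animal above a line carrying the lower ends, at distance \<open>d\<close>, of the two vertical
  bonds of a row. Positions are relative to the left one of these bonds. On the line at the top of
  the row, \<open>s\<close> is the number of bonds in the segment starting at the left bond (at most \<open>d\<close>, so that
  \<open>s = d\<close> means that the gap is closed), and \<open>a < b\<close> are the positions of the vertical bonds of the
  next row. By primitivity the segment starting at the right bond ends at \<open>max d b\<close>, hence its
  length is the truncated difference \<open>b - d\<close> in \<open>upper_weight\<close>.\<close>

datatype upper = Top nat | Step nat nat nat upper

fun upper_height :: "upper \<Rightarrow> nat" where
  "upper_height (Top s) = 0"
| "upper_height (Step s a b U) = Suc (upper_height U)"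

fun valid_upper :: "nat \<Rightarrow> upper \<Rightarrow> bool" where
  "valid_upper d (Top s) \<longleftrightarrow> s \<le> d"
| "valid_upper d (Step s a b U) \<longleftrightarrow>
     s \<le> d \<and> a < b \<and> (a \<le> s \<or> d \<le> a) \<and> (b \<le> s \<or> d \<le> b) \<and> valid_upper (b - a) U"

fun upper_weight :: "nat \<Rightarrow> upper \<Rightarrow> nat" where
  "upper_weight d (Top s) = s"
| "upper_weight d (Step s a b U) = s + (b - d) + upper_weight (b - a) U"

definition uppers :: "nat \<Rightarrow> nat \<Rightarrow> nat \<Rightarrow> upper set" where
  "uppers m d k = {U. valid_upper d U \<and> upper_height U = m \<and> upper_weight d U = k}"

lemma uppers_0: "uppers 0 d k = (if k \<le> d then {Top k} else {})"
proof -
  have "U \<in> uppers 0 d k \<longleftrightarrow> U = Top k \<and> k \<le> d" for U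
    by (cases U) (auto simp: uppers_def)
  then show ?thesis by auto
qed

lemma uppers_Suc:
  "uppers (Suc m) d k = (\<lambda>((s, b, a), U). Step s a b U) `
     (SIGMA (s, b, a) : (SIGMA s : {s. s \<le> d \<and> s \<le> k}. SIGMA b : {b. b \<le> d + (k - s) \<and> (b \<le> s \<or> d \<le> b)}.
        {a. a < b \<and> (a \<le> s \<or> d \<le> a)}). uppers m (b - a) (k - s - (b - d)))" (is "_ = ?R")
proof (intro equalityI subsetI)
  fix V assume V: "V \<in> uppers (Suc m) d k"
  then obtain s a b U where "V = Step s a b U" by (cases V) (auto simp: uppers_def)
  then show "V \<in> ?R" using V
    by (intro image_eqI[of _ _ "((s, b, a), U)"]) (auto simp: uppers_def)
qed (auto simp: uppers_def)

lemma sum_X_power_nth: "(\<Sum>s\<le>d. fps_X ^ s) $ k = (if k \<le> d then 1 else 0 :: complex)"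
proof -
  have "(\<Sum>s\<le>d. fps_X ^ s) $ k = (\<Sum>s\<in>{..d}. if k = s then 1 else 0 :: complex)"
    unfolding fps_sum_nth by (intro sum.cong) (auto simp: fps_X_power_nth)
  then show ?thesis by (simp add: sum.delta')
qed

lemma transfer_nth:
  "transfer h d $ k = (\<Sum>s\<in>{s. s \<le> d \<and> s \<le> k}. \<Sum>b\<in>{b. b \<le> d + (k - s) \<and> (b \<le> s \<or> d \<le> b)}.
     \<Sum>a\<in>{a. a < b \<and> (a \<le> s \<or> d \<le> a)}. h (b - a) $ (k - s - (b - d)))"
proof -
  let ?A = "\<lambda>s b. {a. a < b \<and> (a \<le> s \<or> d \<le> a)}"
  let ?B = "\<lambda>s. {b. b \<le> d \<and> (b \<le> s \<or> d \<le> b)}"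
  let ?c = "\<lambda>s. (\<Sum>b\<in>?B s. \<Sum>a\<in>?A s b. h (b - a)) + tail_sum (\<lambda>e. \<Sum>a\<in>?A s (d + e). h (d + e - a)) 0"
  have c: "?c s $ K = (\<Sum>b\<in>{b. b \<le> d + K \<and> (b \<le> s \<or> d \<le> b)}. \<Sum>a\<in>?A s b. h (b - a) $ (K - (b - d)))"
    if "s \<le> d" for s K
  proof -
    have un: "{b. b \<le> d + K \<and> (b \<le> s \<or> d \<le> b)} = ?B s \<union> {d + 1..d + K}" using that by auto
    have "tail_sum (\<lambda>e. \<Sum>a\<in>?A s (d + e). h (d + e - a)) 0 $ K =
        (\<Sum>e=1..K. \<Sum>a\<in>?A s (d + e). h (d + e - a) $ (K - e))"
      unfolding tail_sum_def
      by (auto simp: fps_X_power_mult_nth fps_sum_nth intro!: sum.cong)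
    also have "\<dots> = (\<Sum>b=d + 1..d + K. \<Sum>a\<in>?A s b. h (b - a) $ (K - (b - d)))"
      by (rule sum.reindex_bij_witness[of _ "\<lambda>b. b - d" "\<lambda>e. d + e"]) auto
    finally have "?c s $ K = (\<Sum>b\<in>?B s. \<Sum>a\<in>?A s b. h (b - a) $ (K - (b - d))) +
        (\<Sum>b=d + 1..d + K. \<Sum>a\<in>?A s b. h (b - a) $ (K - (b - d)))"
      by (simp add: fps_sum_nth)
    also have "\<dots> = (\<Sum>b\<in>{b. b \<le> d + K \<and> (b \<le> s \<or> d \<le> b)}. \<Sum>a\<in>?A s b. h (b - a) $ (K - (b - d)))"
      unfolding un by (rule sum.union_disjoint[symmetric]) auto
    finally show ?thesis .
  qed
  have "transfer h d $ k = (\<Sum>s\<le>d. if k < s then 0 else ?c s $ (k - s))"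
    unfolding transfer_def fps_sum_nth fps_X_power_mult_nth ..
  also have "\<dots> = (\<Sum>s\<in>{s. s \<le> d \<and> s \<le> k}. ?c s $ (k - s))"
    by (intro sum.mono_neutral_cong_right) auto
  also have "\<dots> = (\<Sum>s\<in>{s. s \<le> d \<and> s \<le> k}. \<Sum>b\<in>{b. b \<le> d + (k - s) \<and> (b \<le> s \<or> d \<le> b)}.
     \<Sum>a\<in>?A s b. h (b - a) $ (k - s - (b - d)))"
    by (intro sum.cong c) auto
  finally show ?thesis .
qed

lemma upper_gf_nth: "finite (uppers m d k) \<and> upper_gf m d $ k = of_nat (card (uppers m d k))"
proof (induction m arbitrary: d k)
  case 0
  show ?case by (simp add: uppers_0 sum_X_power_nth)
next
  case (Suc m)
  have fin: "finite {a. a < b \<and> (a \<le> s \<or> d \<le> a)}" "finite {b. b \<le> e \<and> (b \<le> s \<or> d \<le> b)}"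
    "finite {s. s \<le> d \<and> s \<le> k}" for b e s :: nat
    by auto
  have inj: "inj_on (\<lambda>((s, b, a), U). Step s a b U) X" for X
    by (auto simp: inj_on_def)
  show ?case
    unfolding uppers_Suc card_image[OF inj] upper_gf.simps transfer_nth
    using Suc fin
    by (auto simp: card_SigmaI sum.Sigma split_beta intro!: sum.cong)
qed

definition animal_codes :: "nat \<Rightarrow> nat \<Rightarrow> (nat \<times> upper) set" where
  "animal_codes m k = {(d, U). 1 \<le> d \<and> valid_upper d U \<and> upper_height U = m \<and> d + upper_weight d U = k}"

lemma tail_sum_upper_gf_nth: "tail_sum (upper_gf m) 0 $ k = of_nat (card (animal_codes m k))"
proof -
  have "animal_codes m k = (SIGMA d : {1..k}. uppers m d (k - d))"
    by (auto simp: animal_codes_def uppers_def)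
  then have "card (animal_codes m k) = (\<Sum>d=1..k. card (uppers m d (k - d)))"
    using upper_gf_nth by (simp add: card_SigmaI)
  then show ?thesis
    using upper_gf_nth by (auto simp: tail_sum_def fps_X_power_mult_nth intro!: sum.cong)
qed

section \<open>The animal of a code\<close>

definition hseg :: "int \<Rightarrow> int \<Rightarrow> int \<Rightarrow> bond set" where
  "hseg y a b = (\<lambda>u. hbond u y) ` {a..<b}"

fun upper_bonds :: "int \<Rightarrow> int \<Rightarrow> nat \<Rightarrow> upper \<Rightarrow> bond set" where
  "upper_bonds x y d (Top s) =
     {vbond x y, vbond (x + int d) y} \<union> hseg (y + 1) x (x + int s)"
| "upper_bonds x y d (Step s a b U) =
     {vbond x y, vbond (x + int d) y} \<union> hseg (y + 1) x (x + int s) \<union>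
     hseg (y + 1) (x + int d) (x + int b) \<union> upper_bonds (x + int a) (y + 1) (b - a) U"

definition code_animal :: "int \<Rightarrow> int \<Rightarrow> nat \<Rightarrow> upper \<Rightarrow> bond set" where
  "code_animal x y d U = hseg y x (x + int d) \<union> upper_bonds x y d U"

lemma bond_eq_simps [simp]:
  "hbond u v = hbond u' v' \<longleftrightarrow> u = u' \<and> v = v'"
  "vbond u v = vbond u' v' \<longleftrightarrow> u = u' \<and> v = v'"
  "hbond u v \<noteq> vbond u' v'" "vbond u' v' \<noteq> hbond u v"
  by (auto simp: hbond_def vbond_def)

lemma bond_class_simps [simp]:
  "hbond u v \<in> horizontal_bonds" "vbond u v \<in> vertical_bonds"
  "hbond u v \<notin> vertical_bonds" "vbond u v \<notin> horizontal_bonds"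
  "vbond u v \<in> row_bonds j \<longleftrightarrow> v = j" "hbond u v \<notin> row_bonds j"
  by (auto simp: horizontal_bonds_def vertical_bonds_def row_bonds_def)

lemma bond_end_simps [simp]:
  "fst (hbond u v) = (u, v)" "snd (hbond u v) = (u + 1, v)"
  "fst (vbond u v) = (u, v)" "snd (vbond u v) = (u, v + 1)"
  by (auto simp: hbond_def vbond_def)

lemma mem_hseg_simps [simp]:
  "hbond u v \<in> hseg y a b \<longleftrightarrow> v = y \<and> a \<le> u \<and> u < b" "vbond u v \<notin> hseg y a b"
  by (auto simp: hseg_def)

lemma finite_hseg [simp]: "finite (hseg y a b)"
  by (simp add: hseg_def)

lemma card_hseg [simp]: "card (hseg y a b) = nat (b - a)"
  unfolding hseg_def by (subst card_image) (auto simp: inj_on_def)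

lemma hseg_horizontal: "e \<in> hseg y a b \<Longrightarrow> e \<in> horizontal_bonds"
  by (auto simp: hseg_def)

lemma hseg_height: "e \<in> hseg y a b \<Longrightarrow> snd (snd e) = y"
  by (auto simp: hseg_def)

lemma row_height: "e \<in> row_bonds j \<Longrightarrow> snd (snd e) = j + 1"
  by (auto simp: row_bonds_def)

lemma bond_cases:
  assumes "e \<in> horizontal_bonds \<union> vertical_bonds"
  obtains u v where "e = hbond u v" | u v where "e = vbond u v"
  using assms by (auto simp: horizontal_bonds_def vertical_bonds_def)

lemma upper_bonds_subset: "upper_bonds x y d U \<subseteq> horizontal_bonds \<union> vertical_bonds"
  by (induction U arbitrary: x y d) (auto dest: hseg_horizontal)

lemma finite_upper_bonds: "finite (upper_bonds x y d U)"
  by (induction U arbitrary: x y d) auto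

lemma upper_bonds_ge:
  "hbond u v \<in> upper_bonds x y d U \<Longrightarrow> x \<le> u \<and> y + 1 \<le> v"
  "vbond u v \<in> upper_bonds x y d U \<Longrightarrow> x \<le> u \<and> y \<le> v"
  by (induction U arbitrary: x y d) force+

lemma upper_bonds_height:
  assumes "e \<in> upper_bonds x y d U"
  shows "snd (snd e) > y"
proof -
  have "e \<in> horizontal_bonds \<union> vertical_bonds" using assms upper_bonds_subset by blast
  then show ?thesis
    by (cases rule: bond_cases) (use assms upper_bonds_ge[of _ _ x y d U] in fastforce)+
qed

lemma upper_bonds_row: "vbond u y \<in> upper_bonds x y d U \<longleftrightarrow> u = x \<or> u = x + int d"
  by (cases U) (auto dest: upper_bonds_ge)

lemma upper_bonds_vertical_Int:
  "upper_bonds x y d (Top s) \<inter> vertical_bonds = {vbond x y, vbond (x + int d) y}"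
  "upper_bonds x y d (Step s a b U) \<inter> vertical_bonds =
     {vbond x y, vbond (x + int d) y} \<union> (upper_bonds (x + int a) (y + 1) (b - a) U \<inter> vertical_bonds)"
  by (auto simp: hseg_def)

lemma card_upper_bonds_vertical:
  assumes "d \<ge> 1" "valid_upper d U"
  shows "card (upper_bonds x y d U \<inter> vertical_bonds) = 2 * Suc (upper_height U)"
  using assms
proof (induction U arbitrary: x y d)
  case (Top s)
  then show ?case unfolding upper_bonds_vertical_Int by simp
next
  case (Step s a b U)
  have "card (upper_bonds (x + int a) (y + 1) (b - a) U \<inter> vertical_bonds) = 2 * Suc (upper_height U)"
    using Step.prems by (intro Step.IH) auto
  moreover have "{vbond x y, vbond (x + int d) y} \<inter>
      (upper_bonds (x + int a) (y + 1) (b - a) U \<inter> vertical_bonds) = {}"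
    by (auto dest: upper_bonds_ge)
  ultimately show ?case
    using Step.prems finite_upper_bonds unfolding upper_bonds_vertical_Int
    by (subst card_Un_disjoint) auto
qed

lemma card_upper_bonds_horizontal:
  assumes "valid_upper d U"
  shows "card (upper_bonds x y d U \<inter> horizontal_bonds) = upper_weight d U"
  using assms
proof (induction U arbitrary: x y d)
  case (Top s)
  have "upper_bonds x y d (Top s) \<inter> horizontal_bonds = hseg (y + 1) x (x + int s)"
    by (auto dest: hseg_horizontal)
  then show ?case by simp
next
  case (Step s a b U)
  let ?R = "upper_bonds (x + int a) (y + 1) (b - a) U \<inter> horizontal_bonds"
  let ?H1 = "hseg (y + 1) x (x + int s)" and ?H2 = "hseg (y + 1) (x + int d) (x + int b)"
  have IH: "card ?R = upper_weight (b - a) U"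
    using Step.prems by (intro Step.IH) auto
  have eq: "upper_bonds x y d (Step s a b U) \<inter> horizontal_bonds = ?H1 \<union> ?H2 \<union> ?R"
    by (auto dest: hseg_horizontal)
  have "?H1 \<inter> ?H2 = {}" using Step.prems by (auto simp: hseg_def)
  moreover have "(?H1 \<union> ?H2) \<inter> ?R = {}" 
    by (fastforce dest: hseg_height upper_bonds_height)
  moreover have "finite ?R" using finite_upper_bonds by blast
  ultimately show ?case unfolding eq
    by (subst card_Un_disjoint; (subst card_Un_disjoint)?) (auto simp: IH)
qed

lemma card_upper_bonds_row:
  assumes "d \<ge> 1" "valid_upper d U" "upper_bonds x y d U \<inter> row_bonds j \<noteq> {}"
  shows "card (upper_bonds x y d U \<inter> row_bonds j) = 2"
  using assms
proof (induction U arbitrary: x y d)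
  case (Top s)
  have "upper_bonds x y d (Top s) \<inter> row_bonds j = (if j = y then {vbond x y, vbond (x + int d) y} else {})"
    by (auto simp: hseg_def)
  then show ?case using Top by (auto split: if_splits)
next
  case (Step s a b U)
  let ?R = "upper_bonds (x + int a) (y + 1) (b - a) U \<inter> row_bonds j"
  have eq: "upper_bonds x y d (Step s a b U) \<inter> row_bonds j =
      (if j = y then {vbond x y, vbond (x + int d) y} else {}) \<union> ?R"
    by (auto simp: hseg_def)
  show ?case
  proof (cases "j = y")
    case True
    then have "?R = {}" by (fastforce dest: row_height upper_bonds_height)
    then show ?thesis using True Step.prems unfolding eq by simp
  next
    case False
    then show ?thesis using Step.prems unfolding eq by (auto intro!: Step.IH)
  qed
qed

lemma hseg_reach:
  assumes "hseg y a b \<subseteq> A" "(r, (a, y)) \<in> A\<^sup>*" "a \<le> u" "u \<le> b"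
  shows "(r, (u, y)) \<in> A\<^sup>*"
  using assms(3,4)
proof (induction u rule: int_ge_induct)
  case base
  show ?case by (rule assms(2))
next
  case (step u)
  then have "hbond u y \<in> A" using assms(1) by auto
  with step show ?case by (auto simp: hbond_def intro: rtrancl_into_rtrancl)
qed

lemma upper_bonds_reach:
  assumes "upper_bonds x y d U \<subseteq> A" "(r, (x, y)) \<in> A\<^sup>*" "(r, (x + int d, y)) \<in> A\<^sup>*"
    "valid_upper d U" "e \<in> upper_bonds x y d U"
  shows "(r, fst e) \<in> A\<^sup>*"
  using assms
proof (induction U arbitrary: x y d)
  case (Top s)
  have "vbond x y \<in> A" using Top.prems(1) by simp
  with Top.prems(2) have "(r, (x, y + 1)) \<in> A\<^sup>*" by (auto simp: vbond_def intro: rtrancl_into_rtrancl)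
  then have "(r, (u, y + 1)) \<in> A\<^sup>*" if "x \<le> u" "u \<le> x + int s" for u
    using hseg_reach[of "y + 1" x "x + int s" A r u] that Top.prems(1) by simp
  then show ?case using Top.prems by (auto simp: hseg_def)
next
  case (Step s a b U)
  have "vbond x y \<in> A" "vbond (x + int d) y \<in> A" using Step.prems(1) by simp_all
  with Step.prems(2,3) have "(r, (x, y + 1)) \<in> A\<^sup>*" "(r, (x + int d, y + 1)) \<in> A\<^sup>*"
    by (auto simp: vbond_def intro: rtrancl_into_rtrancl)
  then have *: "(r, (u, y + 1)) \<in> A\<^sup>*"
    if "x \<le> u \<and> u \<le> x + int s \<or> u = x + int d \<or> x + int d \<le> u \<and> u \<le> x + int b" for u
    using hseg_reach[of "y + 1" x "x + int s" A r u]
      hseg_reach[of "y + 1" "x + int d" "x + int b" A r u] that Step.prems(1) by auto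
  have "(r, fst e) \<in> A\<^sup>*" if "e \<in> upper_bonds (x + int a) (y + 1) (b - a) U"
  proof (rule Step.IH[OF _ _ _ _ that])
    show "(r, (x + int a, y + 1)) \<in> A\<^sup>*" using Step.prems(4) by (intro *) auto
    have "(r, (x + int b, y + 1)) \<in> A\<^sup>*" using Step.prems(4) by (intro *) auto
    then show "(r, (x + int a + int (b - a), y + 1)) \<in> A\<^sup>*" using Step.prems(4) by (simp add: of_nat_diff)
  qed (use Step.prems in auto)
  then show ?case using Step.prems * by (auto simp: hseg_def)
qed

lemma upper_bonds_line_vertex:
  assumes "upper_bonds x y d U \<subseteq> A" "valid_upper d U" "hbond u v \<in> upper_bonds x y d U" "w = u \<or> w = u + 1"
  shows "between_vertical_bonds A (w, v) \<or> hbond (w - 1) v \<in> A \<and> hbond w v \<in> A"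
  using assms
proof (induction U arbitrary: x y d)
  case (Top s)
  then have "v = y + 1" "x \<le> w" "w \<le> x + int d" by auto
  moreover have "vbond x y \<in> A" "vbond (x + int d) y \<in> A" using Top.prems(1) by simp_all
  ultimately have "between_vertical_bonds A (w, v)"
    unfolding between_vertical_bonds_def by force
  then show ?case ..
next
  case (Step s a b U)
  have V: "vbond x y \<in> A" "vbond (x + int d) y \<in> A" using Step.prems(1) by simp_all
  have low: "between_vertical_bonds A (w, v)" if "v = y + 1" "x \<le> w" "w \<le> x + int d"
    unfolding between_vertical_bonds_def using that V by force
  have R: "upper_bonds (x + int a) (y + 1) (b - a) U \<subseteq> A" using Step.prems(1) by simp
  have "vbond (x + int a) (y + 1) \<in> A" "vbond (x + int b) (y + 1) \<in> A"
    using R upper_bonds_row[of _ "y + 1" "x + int a" "b - a" U] Step.prems(2) by (auto simp: of_nat_diff)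
  then have high: "between_vertical_bonds A (w, v)" if "v = y + 1" "x + int a \<le> w" "w \<le> x + int b"
    unfolding between_vertical_bonds_def using that by force
  consider "v = y + 1" "x \<le> u" "u < x + int s" | "v = y + 1" "x + int d \<le> u" "u < x + int b"
    | "hbond u v \<in> upper_bonds (x + int a) (y + 1) (b - a) U"
    using Step.prems(3) by auto
  then show ?case
  proof cases
    case 1
    then show ?thesis using low Step.prems by auto
  next
    case 2
    have H: "hbond i v \<in> A" if "x + int d \<le> i" "i < x + int b" for i
      using Step.prems(1) that 2 by auto
    consider "w \<le> x + int d" | "x + int a \<le> w" | "x + int d < w" "w < x + int a" by linarith
    then show ?thesis
    proof cases
      case 3
      then show ?thesis using H[of "w - 1"] H[of w] Step.prems(2) by auto
    qed (use 2 low high Step.prems(4) in auto)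
  next
    case 3
    then show ?thesis using Step.IH[OF R _ 3 Step.prems(4)] Step.prems(2) by auto
  qed
qed

lemma vertical_end_between:
  assumes "vbond u v \<in> A"
  shows "between_vertical_bonds A (u, v)" "between_vertical_bonds A (u, v + 1)"
  using assms unfolding between_vertical_bonds_def by force+

lemma code_animal_primitive:
  assumes d: "d \<ge> 1" and U: "valid_upper d U"
  shows "primitive_two_directed (code_animal x y d U)"
proof -
  define A where "A = code_animal x y d U"
  have sub: "A \<subseteq> horizontal_bonds \<union> vertical_bonds"
    using upper_bonds_subset by (auto simp: A_def code_animal_def dest: hseg_horizontal)
  have fin: "finite A" by (simp add: A_def code_animal_def finite_upper_bonds)
  have UA: "upper_bonds x y d U \<subseteq> A" and HA: "hseg y x (x + int d) \<subseteq> A"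
    by (auto simp: A_def code_animal_def)
  have V: "vbond x y \<in> A" "vbond (x + int d) y \<in> A"
    using UA upper_bonds_row by blast+
  have base: "((x, y), (u, y)) \<in> A\<^sup>*" if "x \<le> u" "u \<le> x + int d" for u
    by (rule hseg_reach[OF HA _ that]) simp
  have reach: "((x, y), fst e) \<in> A\<^sup>*" if "e \<in> A" for e
  proof (cases "e \<in> upper_bonds x y d U")
    case True
    then show ?thesis using base U by (intro upper_bonds_reach[OF UA]) auto
  next
    case False
    then show ?thesis using that base by (auto simp: A_def code_animal_def hseg_def)
  qed
  have reach2: "((x, y), u) \<in> A\<^sup>*" if "u \<in> Field A" for u
  proof -
    have "(\<exists>v. (u, v) \<in> A) \<or> (\<exists>v. (v, u) \<in> A)" using that by (auto simp: Field_def)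
    then obtain e where e: "e \<in> A" "u = fst e \<or> u = snd e" by (metis fst_conv snd_conv)
    have "(fst e, snd e) \<in> A" using e(1) by simp
    with reach[OF e(1)] e(2) show ?thesis by (auto intro: rtrancl_into_rtrancl)
  qed
  have "(u, v) \<in> (A \<union> A\<inverse>)\<^sup>*" if "u \<in> Field A" "v \<in> Field A" for u v
  proof -
    have "(u, (x, y)) \<in> (A\<inverse>)\<^sup>*" using reach2[OF that(1)] by (simp add: rtrancl_converse)
    then have "(u, (x, y)) \<in> (A \<union> A\<inverse>)\<^sup>*" by (rule rtrancl_mono[THEN subsetD, rotated]) blast
    moreover have "((x, y), v) \<in> (A \<union> A\<inverse>)\<^sup>*"
      using reach2[OF that(2)] by (rule rtrancl_mono[THEN subsetD, rotated]) blast
    ultimately show ?thesis by (rule rtrancl_trans)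
  qed
  then have "bond_animal A" unfolding bond_animal_def using sub fin V by blast
  moreover have "(x, y) \<in> Field A" using V(1) by (force simp: vbond_def Field_def)
  ultimately have "directed_animal A" unfolding directed_animal_def using reach by force
  moreover have "A \<inter> row_bonds j = upper_bonds x y d U \<inter> row_bonds j" for j
    by (auto simp: A_def code_animal_def hseg_def)
  ultimately have two: "two_directed_animal A"
    unfolding two_directed_animal_def using card_upper_bonds_row[OF d U] by simp
  have "between_vertical_bonds A w" if deg: "degree_in A w = 1" for w
  proof -
    obtain w1 w2 where w: "w = (w1, w2)" by (cases w)
    have "{e \<in> A. fst e = w \<or> snd e = w} \<noteq> {}"
      using deg unfolding degree_in_def by (metis card.empty zero_neq_one)
    then obtain e where e: "e \<in> A" "fst e = w \<or> snd e = w" by blast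
    have "\<not> (hbond (w1 - 1) w2 \<in> A \<and> hbond w1 w2 \<in> A)"
    proof
      assume "hbond (w1 - 1) w2 \<in> A \<and> hbond w1 w2 \<in> A"
      then have "{hbond (w1 - 1) w2, hbond w1 w2} \<subseteq> {e \<in> A. fst e = w \<or> snd e = w}"
        by (auto simp: w)
      then have "card {hbond (w1 - 1) w2, hbond w1 w2} \<le> degree_in A w"
        unfolding degree_in_def using fin by (intro card_mono) auto
      then show False using deg by simp
    qed
    note line = this
    from e(1) sub have "e \<in> horizontal_bonds \<union> vertical_bonds" by blast
    then show ?thesis
    proof (cases rule: bond_cases)
      case (1 u v)
      then have uv: "v = w2" "w1 = u \<or> w1 = u + 1" using e(2) w by auto
      show ?thesis
      proof (cases "e \<in> upper_bonds x y d U")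
        case True
        then show ?thesis
          using upper_bonds_line_vertex[OF UA U _ uv(2), of v] line 1 uv(1) w by auto
      next
        case False
        then have "w2 = y" "x \<le> w1" "w1 \<le> x + int d"
          using e(1) 1 uv by (auto simp: A_def code_animal_def)
        then show ?thesis using V w unfolding between_vertical_bonds_def by force
      qed
    next
      case (2 u v)
      then show ?thesis using e vertical_end_between[of u v A] by auto
    qed
  qed
  with two show ?thesis by (simp add: primitive_two_directed_def A_def)
qed

lemma upper_bonds_above:
  "upper_bonds (x + int a) (y + 1) (b - a) U = {e \<in> upper_bonds x y d (Step s a b U). snd (snd e) > y + 1}"
  by (auto simp: vbond_def dest: hseg_height upper_bonds_height)

lemma upper_bonds_line:
  "hbond u (y + 1) \<in> upper_bonds x y d (Top s) \<longleftrightarrow> x \<le> u \<and> u < x + int s"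
  "hbond u (y + 1) \<in> upper_bonds x y d (Step s a b U) \<longleftrightarrow>
     x \<le> u \<and> u < x + int s \<or> x + int d \<le> u \<and> u < x + int b"
  by (auto dest: upper_bonds_ge)

lemma initial_interval_eq:
  assumes "\<And>u. u < x + int d \<Longrightarrow> x \<le> u \<and> u < x + int s \<longleftrightarrow> x \<le> u \<and> u < x + int t" "s \<le> d" "t \<le> d"
  shows "s = t"
proof (rule ccontr)
  assume "s \<noteq> t"
  then show False
    using assms(1)[of "x + int (min s t)"] assms(2,3) by (cases s t rule: linorder_cases) auto
qed

lemma upper_bonds_inj:
  assumes "upper_bonds x y d U = upper_bonds x y d' U'" "d \<ge> 1" "d' \<ge> 1" "valid_upper d U" "valid_upper d' U'"
  shows "d = d' \<and> U = U'"
  using assms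
proof (induction U arbitrary: x y d d' U')
  case (Top s)
  have "x + int d = x \<or> x + int d = x + int d'" using upper_bonds_row Top.prems(1) by metis
  then have d: "d = d'" using Top.prems by auto
  show ?case
  proof (cases U')
    case (Top t)
    have "s = t"
    proof (rule initial_interval_eq[of x d])
      show "x \<le> u \<and> u < x + int s \<longleftrightarrow> x \<le> u \<and> u < x + int t" for u
        using upper_bonds_line(1)[of u y x d s] upper_bonds_line(1)[of u y x d' t] Top.prems(1) Top
        by (simp del: upper_bonds.simps)
    qed (use Top.prems Top d in auto)
    then show ?thesis using d Top by simp
  next
    case (Step t a b V)
    have "vbond (x + int a) (y + 1) \<in> upper_bonds x y d' U'" using upper_bonds_row Step by auto
    then show ?thesis unfolding Top.prems(1)[symmetric] by auto
  qed
next
  case (Step s a b U)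
  have "x + int d = x \<or> x + int d = x + int d'" using upper_bonds_row Step.prems(1) by metis
  then have d: "d = d'" using Step.prems by auto
  show ?case
  proof (cases U')
    case (Top t)
    have "vbond (x + int a) (y + 1) \<in> upper_bonds x y d (Step s a b U)" using upper_bonds_row by auto
    then show ?thesis unfolding Step.prems(1) Top by auto
  next
    case (Step t a' b' V)
    have R: "upper_bonds (x + int a) (y + 1) (b - a) U = upper_bonds (x + int a') (y + 1) (b' - a') V"
      unfolding upper_bonds_above[of x a y b U d s] upper_bonds_above[of x a' y b' V d' t]
        Step.prems(1) Step ..
    have ab: "a < b" "a' < b'" using Step.prems Step by auto
    have "u = x + int a \<or> u = x + int b \<longleftrightarrow> u = x + int a' \<or> u = x + int b'" for u
      using R upper_bonds_row[of u "y + 1" "x + int a" "b - a" U]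
        upper_bonds_row[of u "y + 1" "x + int a'" "b' - a'" V] ab by (auto simp: of_nat_diff)
    from this[of "x + int a"] this[of "x + int b"] this[of "x + int a'"] ab
    have ab': "a = a'" "b = b'" by auto
    have "s = t"
    proof (rule initial_interval_eq[of x d])
      fix u assume "u < x + int d"
      then show "x \<le> u \<and> u < x + int s \<longleftrightarrow> x \<le> u \<and> u < x + int t"
        using upper_bonds_line(2)[of u y x d s a b U] upper_bonds_line(2)[of u y x d' t a' b' V]
          Step.prems(1) Step d by (simp del: upper_bonds.simps)
    qed (use Step.prems Step d in auto)
    moreover have "b - a = b' - a' \<and> U = V"
      using R ab ab' Step.prems Step by (intro Step.IH[of "x + int a" "y + 1"]) auto
    ultimately show ?thesis using d ab' Step by simp
  qed
qed

lemma translate_hseg: "translate (s, t) (hseg y a b) = hseg (y + t) (a + s) (b + s)"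
proof -
  have "(\<lambda>(u, v). (u + (s, t), v + (s, t))) (hbond u y) = hbond (u + s) (y + t)" for u
    by (simp add: hbond_def)
  then have "translate (s, t) (hseg y a b) = (\<lambda>u. hbond u (y + t)) ` ((\<lambda>u. u + s) ` {a..<b})"
    unfolding translate_def hseg_def image_image by simp
  also have "(\<lambda>u. u + s) ` {a..<b} = {a + s..<b + s}" by simp
  finally show ?thesis by (simp add: hseg_def)
qed

lemma translate_vbond: "translate (s, t) {vbond a y, vbond b y} = {vbond (a + s) (y + t), vbond (b + s) (y + t)}"
  by (auto simp: translate_def vbond_def algebra_simps)

lemma translate_Un: "translate v (A \<union> B) = translate v A \<union> translate v B"
  by (auto simp: translate_def)

lemma translate_upper_bonds: "translate (s, t) (upper_bonds x y d U) = upper_bonds (x + s) (y + t) d U"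
proof (induction U arbitrary: x y d)
  case (Top k)
  show ?case unfolding upper_bonds.simps translate_Un translate_vbond translate_hseg
    by (simp add: add_ac)
next
  case (Step k a b U)
  show ?case unfolding upper_bonds.simps translate_Un translate_vbond translate_hseg Step
    by (simp add: add_ac)
qed

lemma translate_code_animal: "translate (s, t) (code_animal x y d U) = code_animal (x + s) (y + t) d U"
  unfolding code_animal_def translate_Un translate_hseg translate_upper_bonds by (simp add: add_ac)

lemma code_animal_inj:
  assumes "code_animal x y d U = code_animal x' y' d' U'" "d \<ge> 1" "d' \<ge> 1" "valid_upper d U" "valid_upper d' U'"
  shows "d = d' \<and> U = U'"
proof -
  have V: "vbond x y \<in> code_animal x y d U" for x y d U
    by (simp add: code_animal_def upper_bonds_row)
  have ge: "x \<le> u \<and> y \<le> v" if "vbond u v \<in> code_animal x y d U" for x y u v d U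
    using that by (auto simp: code_animal_def dest: upper_bonds_ge)
  have xy: "x = x'" "y = y'"
    using ge[of x y x' y' d' U'] ge[of x' y' x y d U] V[of x y d U] V[of x' y' d' U'] assms(1) by auto
  have up: "upper_bonds x y d U = {e \<in> code_animal x y d U. snd (snd e) > y}" for x y d U
    by (fastforce simp: code_animal_def dest: hseg_height upper_bonds_height)
  have "code_animal x y d U = code_animal x y d' U'" using assms(1) xy by simp
  then have "upper_bonds x y d U = upper_bonds x y d' U'" unfolding up by simp
  then show ?thesis using assms(2-) by (rule upper_bonds_inj)
qed

lemma finite_int_initial_segment:
  fixes C :: "int set"
  assumes "finite C" "\<And>u. u \<in> C \<Longrightarrow> p \<le> u \<and> {p..u} \<subseteq> C"
  shows "C = {p..<p + int (card C)}"
proof (cases "C = {}")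
  case False
  define M where "M = Max C"
  have M: "M \<in> C" "\<And>u. u \<in> C \<Longrightarrow> u \<le> M" using assms(1) False by (auto simp: M_def)
  then have "C = {p..M}" "p \<le> M" using assms(2) by fastforce+
  then show ?thesis by auto
qed simp

lemma two_segments:
  fixes H :: "int set"
  assumes "finite H" and pred: "\<And>u. u \<in> H \<Longrightarrow> u = x \<or> u = x + int d \<or> u - 1 \<in> H"
  obtains s t where "s \<le> d" "H = {x..<x + int s} \<union> {x + int d..<x + int d + int t}"
proof -
  obtain m where m: "\<And>u. u \<in> H \<Longrightarrow> m \<le> u"
    using assms(1) by (meson bdd_below.unfold bdd_below_finite)
  have chain: "\<exists>p\<in>{x, x + int d}. p \<le> u \<and> {p..u} \<subseteq> H" if "u \<in> H" for u
    using m[OF that] that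
  proof (induction u rule: int_ge_induct)
    case base
    then show ?case using pred[of m] m[of "m - 1"] by auto
  next
    case (step u)
    have *: "{p..u + 1} \<subseteq> insert (u + 1) {p..u}" for p by auto
    from pred[OF step.prems] consider "u + 1 = x \<or> u + 1 = x + int d" | "u \<in> H" by auto
    then show ?case
    proof cases
      case 1
      then show ?thesis using step.prems by auto
    next
      case 2
      then obtain p where "p \<in> {x, x + int d}" "p \<le> u" "{p..u} \<subseteq> H" using step.IH by blast
      then show ?thesis using *[of p] step.prems by (intro bexI[of _ p]) auto
    qed
  qed
  define L where "L = H \<inter> {..<x + int d}"
  define R where "R = H \<inter> {x + int d..}"
  have L: "L = {x..<x + int (card L)}"
  proof (rule finite_int_initial_segment)
    fix u assume "u \<in> L"
    then show "x \<le> u \<and> {x..u} \<subseteq> L" using chain[of u] by (auto simp: L_def)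
  qed (use assms(1) in \<open>simp add: L_def\<close>)
  have R: "R = {x + int d..<x + int d + int (card R)}"
  proof (rule finite_int_initial_segment)
    fix u assume "u \<in> R"
    then show "x + int d \<le> u \<and> {x + int d..u} \<subseteq> R" using chain[of u] by (auto simp: R_def)
  qed (use assms(1) in \<open>simp add: R_def\<close>)
  have "u \<in> {x..<x + int d}" if "u \<in> L" for u
  proof -
    have "u \<in> {x..<x + int (card L)}" using that by (simp only: L[symmetric])
    with that show ?thesis by (auto simp: L_def)
  qed
  then have "L \<subseteq> {x..<x + int d}" by blast
  then have "card L \<le> card {x..<x + int d}" by (intro card_mono) auto
  then have "card L \<le> d" by simp
  moreover have "H = L \<union> R" by (auto simp: L_def R_def)
  then have "H = {x..<x + int (card L)} \<union> {x + int d..<x + int d + int (card R)}"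
    by (simp only: L[symmetric] R[symmetric])
  ultimately show ?thesis by (rule that)
qed

section \<open>Every primitive animal has a code\<close>

locale rooted_animal =
  fixes A :: "bond set" and r :: vertex
  assumes bonds: "A \<subseteq> horizontal_bonds \<union> vertical_bonds"
    and finite_bonds: "finite A"
    and reach: "e \<in> A \<Longrightarrow> (r, fst e) \<in> A\<^sup>*"
    and row_card: "A \<inter> row_bonds j \<noteq> {} \<Longrightarrow> card (A \<inter> row_bonds j) = 2"
    and primitive: "degree_in A v = 1 \<Longrightarrow> between_vertical_bonds A v"
begin

lemma bond_step:
  assumes "(u, v) \<in> A"
  obtains "(u, v) = hbond (fst u) (snd u)" "snd v = snd u"
  | "(u, v) = vbond (fst u) (snd u)" "snd v = snd u + 1"
proof -
  have "(u, v) \<in> horizontal_bonds \<union> vertical_bonds" using assms bonds by blast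
  then show ?thesis
    by (cases rule: bond_cases) (use that in \<open>auto simp: hbond_def vbond_def\<close>)
qed

lemma reach_height_ge: "(r, u) \<in> A\<^sup>* \<Longrightarrow> snd r \<le> snd u"
proof (induction rule: rtrancl_induct)
  case (step u v)
  from step.hyps(2) show ?case by (cases rule: bond_step) (use step.IH in auto)
qed simp

lemma bond_height_ge: "e \<in> A \<Longrightarrow> snd r \<le> snd (fst e)"
  using reach reach_height_ge by blast

lemma predecessor:
  assumes "e \<in> A" "fst e = (u, v)" "(u, v) \<noteq> r"
  shows "hbond (u - 1) v \<in> A \<or> vbond u (v - 1) \<in> A"
proof -
  have "(r, (u, v)) \<in> A\<^sup>*" using reach[OF assms(1)] assms(2) by simp
  then obtain w where "(w, (u, v)) \<in> A" using assms(3) by (auto elim: rtranclE)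
  moreover from this have "(w, (u, v)) = hbond (u - 1) v \<or> (w, (u, v)) = vbond u (v - 1)"
    by (cases rule: bond_step) (auto simp: hbond_def vbond_def prod_eq_iff)
  ultimately show ?thesis by auto
qed

lemma above_empty_row:
  assumes "A \<inter> row_bonds j = {}" "snd r \<le> j" "e \<in> A"
  shows "snd (snd e) \<le> j"
proof -
  have step: "snd v \<le> j" if "(u, v) \<in> A" "snd u \<le> j" for u v
    using that(1)
  proof (cases rule: bond_step)
    case 2
    then have "vbond (fst u) (snd u) \<in> A" using that(1) by simp
    then have "snd u \<noteq> j" using assms(1) bond_class_simps(5) by blast
    then show ?thesis using that(2) 2 by simp
  qed (use that(2) in simp)
  have "snd u \<le> j" if "(r, u) \<in> A\<^sup>*" for u
    using that by (induction rule: rtrancl_induct) (use assms(2) step in auto)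
  then show ?thesis using step[of "fst e" "snd e"] reach[OF assms(3)] assms(3) by simp
qed

lemma two_in_row:
  assumes "A \<inter> row_bonds j \<noteq> {}"
  obtains p q where "p < q" "\<And>u. vbond u j \<in> A \<longleftrightarrow> u = p \<or> u = q"
proof -
  obtain e f where ef: "A \<inter> row_bonds j = {e, f}" "e \<noteq> f"
    using row_card[OF assms] unfolding card_2_iff by blast
  then have "e \<in> row_bonds j" "f \<in> row_bonds j" by auto
  then obtain p q where pq: "e = vbond p j" "f = vbond q j" by (auto simp: row_bonds_def)
  have "vbond u j \<in> A \<longleftrightarrow> vbond u j \<in> A \<inter> row_bonds j" for u by simp
  then have *: "vbond u j \<in> A \<longleftrightarrow> u = p \<or> u = q" for u unfolding ef(1) pq by simp
  show ?thesis
  proof (cases "p < q")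
    case True
    then show ?thesis using that * by blast
  next
    case False
    then show ?thesis using that[of q p] * ef(2) pq by auto
  qed
qed

lemma between_if_single:
  assumes "f \<in> A" "fst f = (w, v) \<or> snd f = (w, v)"
    and "\<And>e. e \<in> A \<Longrightarrow> e \<in> {hbond w v, vbond w v, hbond (w - 1) v, vbond w (v - 1)} \<Longrightarrow> e = f"
  shows "between_vertical_bonds A (w, v)"
proof (rule primitive)
  have "e = f" if e: "e \<in> A" "fst e = (w, v) \<or> snd e = (w, v)" for e
  proof -
    have "e \<in> horizontal_bonds \<union> vertical_bonds" using e bonds by blast
    then have "e \<in> {hbond w v, vbond w v, hbond (w - 1) v, vbond w (v - 1)}"
      by (cases rule: bond_cases) (use e(2) in auto)
    with e(1) show ?thesis by (rule assms(3))
  qed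
  then have "{e \<in> A. fst e = (w, v) \<or> snd e = (w, v)} = {f}" using assms(1,2) by blast
  then show "degree_in A (w, v) = 1" by (simp add: degree_in_def)
qed

lemma finite_line: "finite {u. hbond u v \<in> A}"
proof -
  have "finite ((\<lambda>u. hbond u v) -` A)"
    by (intro finite_vimageI finite_bonds) (auto simp: inj_on_def)
  then show ?thesis by (simp add: vimage_def)
qed

lemma upper_exists:
  assumes "d \<ge> 1" "\<And>u. vbond u y \<in> A \<longleftrightarrow> u = x \<or> u = x + int d" "snd r \<le> y"
  shows "\<exists>U. valid_upper d U \<and> {e \<in> A. snd (snd e) > y} = upper_bonds x y d U"
  using assms
proof (induction "card {e \<in> A. snd (snd e) > y}" arbitrary: x y d rule: less_induct)
  case less
  note row = less.prems(2)
  have pred: "u = x \<or> u = x + int d \<or> hbond (u - 1) (y + 1) \<in> A"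
    if "e \<in> A" "fst e = (u, y + 1)" for e u
  proof -
    have "(u, y + 1) \<noteq> r" using less.prems(3) by auto
    then show ?thesis using predecessor[OF that] row[of u] by auto
  qed
  obtain s t where st: "s \<le> d"
    "{u. hbond u (y + 1) \<in> A} = {x..<x + int s} \<union> {x + int d..<x + int d + int t}"
  proof (rule two_segments)
    show "finite {u. hbond u (y + 1) \<in> A}" by (rule finite_line)
    show "u = x \<or> u = x + int d \<or> u - 1 \<in> {u. hbond u (y + 1) \<in> A}"
      if "u \<in> {u. hbond u (y + 1) \<in> A}" for u
      using pred[of "hbond u (y + 1)" u] that by auto
  qed
  have line: "hbond u (y + 1) \<in> A \<longleftrightarrow> x \<le> u \<and> u < x + int s \<or> x + int d \<le> u \<and> u < x + int d + int t" for u
    using st(2) by (auto simp: set_eq_iff)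
  have right_end: "\<exists>b. vbond b (y + 1) \<in> A \<and> x + int d + int t \<le> b" if "t > 0"
  proof (cases "vbond (x + int d + int t) (y + 1) \<in> A")
    case False
    have "between_vertical_bonds A (x + int d + int t, y + 1)"
      by (rule between_if_single[of "hbond (x + int d + int t - 1) (y + 1)"])
        (use False that st(1) in \<open>auto simp: line row\<close>)
    then show ?thesis
      using row that by (fastforce simp: between_vertical_bonds_def)
  qed auto
  have split: "{e \<in> A. snd (snd e) > y} =
      {vbond x y, vbond (x + int d) y} \<union> hseg (y + 1) x (x + int s) \<union>
      hseg (y + 1) (x + int d) (x + int d + int t) \<union> {e \<in> A. snd (snd e) > y + 1}" (is "?L = ?R")
  proof (rule set_eqI)
    fix e
    show "e \<in> ?L \<longleftrightarrow> e \<in> ?R"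
    proof (cases "e \<in> horizontal_bonds \<union> vertical_bonds")
      case True
      then show ?thesis
      proof (cases rule: bond_cases)
        case (1 u v)
        have "v = y + 1 \<Longrightarrow> e \<in> ?L \<longleftrightarrow> e \<in> ?R" using line[of u] 1 by auto
        then show ?thesis using 1 by (cases "v = y + 1") auto
      next
        case (2 u v)
        then show ?thesis using row[of u] by (cases "v = y") auto
      qed
    next
      case False
      then show ?thesis using bonds bond_class_simps(1,2) hseg_horizontal by blast
    qed
  qed
  show ?case
  proof (cases "A \<inter> row_bonds (y + 1) = {}")
    case True
    then have "t = 0" using right_end by fastforce
    moreover have "{e \<in> A. snd (snd e) > y + 1} = {}"
      using above_empty_row[OF True] less.prems(3) by fastforce
    moreover have "hseg (y + 1) (x + int d) (x + int d + int 0) = {}" by (simp add: hseg_def)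
    ultimately have "{e \<in> A. snd (snd e) > y} = upper_bonds x y d (Top s)"
      unfolding split by (simp only: upper_bonds.simps Un_empty_right)
    then show ?thesis using st(1) by (intro exI[of _ "Top s"]) simp
  next
    case False
    then obtain p q where pq: "p < q" "\<And>u. vbond u (y + 1) \<in> A \<longleftrightarrow> u = p \<or> u = q"
      by (rule two_in_row) blast
    have pos: "x \<le> u \<and> u \<le> x + int s \<or> x + int d \<le> u \<and> u \<le> x + int d + int t"
      if "vbond u (y + 1) \<in> A" for u
      using pred[OF that] line[of "u - 1"] by auto
    from pos[of p] pos[of q] pq have
      p: "x \<le> p \<and> p \<le> x + int s \<or> x + int d \<le> p \<and> p \<le> x + int d + int t" and
      q: "x \<le> q \<and> q \<le> x + int s \<or> x + int d \<le> q \<and> q \<le> x + int d + int t" by auto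
    have xp: "x \<le> p" using p by auto
    have q_ge: "x + int d + int t \<le> q" if "t > 0"
      using right_end[OF that] pq by auto
    define a where "a = nat (p - x)"
    define b where "b = nat (q - x)"
    have ab: "p = x + int a" "q = x + int b" "a < b"
      using xp pq(1) by (auto simp: a_def b_def)
    have "\<exists>U. valid_upper (b - a) U \<and> {e \<in> A. snd (snd e) > y + 1} = upper_bonds p (y + 1) (b - a) U"
    proof (rule less.hyps)
      have "vbond x y \<in> {e \<in> A. snd (snd e) > y}" using row by simp
      then have "{e \<in> A. snd (snd e) > y + 1} \<subset> {e \<in> A. snd (snd e) > y}" by force
      then show "card {e \<in> A. snd (snd e) > y + 1} < card {e \<in> A. snd (snd e) > y}"
        by (intro psubset_card_mono) (simp_all add: finite_bonds)
    qed (use ab pq less.prems(3) in auto)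
    then obtain U where U: "valid_upper (b - a) U"
      "{e \<in> A. snd (snd e) > y + 1} = upper_bonds p (y + 1) (b - a) U" by blast
    have "hseg (y + 1) (x + int d) (x + int d + int t) = hseg (y + 1) (x + int d) (x + int b)"
      using q q_ge ab st(1) by (cases "t = 0") (auto simp: hseg_def)
    then have "{e \<in> A. snd (snd e) > y} = upper_bonds x y d (Step s a b U)"
      unfolding split U(2) ab(1) by simp
    moreover have "valid_upper d (Step s a b U)"
      using U(1) st(1) p q ab by auto
    ultimately show ?thesis by blast
  qed
qed

lemma code_exists:
  assumes "A \<inter> vertical_bonds \<noteq> {}"
  shows "\<exists>d U. d \<ge> 1 \<and> valid_upper d U \<and> A = code_animal (fst r) (snd r) d U"
proof -
  define x where "x = fst r"
  define y where "y = snd r"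
  have r: "r = (x, y)" by (simp add: x_def y_def)
  have low: "vbond u (y - 1) \<notin> A" for u
    using bond_height_ge[of "vbond u (y - 1)"] by (auto simp: y_def)
  have pred: "u = x \<or> hbond (u - 1) y \<in> A" if "e \<in> A" "fst e = (u, y)" for e u
    using predecessor[OF that] low r by auto
  have "A \<inter> row_bonds y \<noteq> {}"
  proof
    assume *: "A \<inter> row_bonds y = {}"
    obtain e where e: "e \<in> A" "e \<in> vertical_bonds" using assms by blast
    then obtain u v where "e = vbond u v" by (auto simp: vertical_bonds_def)
    then show False
      using above_empty_row[OF * _ e(1)] bond_height_ge[OF e(1)] by (simp add: y_def)
  qed
  then obtain p q where pq: "p < q" "\<And>u. vbond u y \<in> A \<longleftrightarrow> u = p \<or> u = q"
    by (rule two_in_row) blast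
  obtain s t where st: "s \<le> 0"
    "{u. hbond u y \<in> A} = {x..<x + int s} \<union> {x + int 0..<x + int 0 + int t}"
  proof (rule two_segments)
    show "finite {u. hbond u y \<in> A}" by (rule finite_line)
    show "u = x \<or> u = x + int 0 \<or> u - 1 \<in> {u. hbond u y \<in> A}"
      if "u \<in> {u. hbond u y \<in> A}" for u
      using pred[of "hbond u y" u] that by auto
  qed
  have line: "hbond u y \<in> A \<longleftrightarrow> x \<le> u \<and> u < x + int t" for u
    using st by (auto simp: set_eq_iff)
  have pos: "x \<le> u \<and> u \<le> x + int t" if "vbond u y \<in> A" for u
    using pred[OF that] line[of "u - 1"] by auto
  have p: "x \<le> p" and q: "q \<le> x + int t" using pos[of p] pos[of q] pq by auto
  have "p = x"
  proof (rule ccontr)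
    assume "p \<noteq> x"
    then have "between_vertical_bonds A (x, y)"
      using p q pq low by (intro between_if_single[of "hbond x y"]) (auto simp: line)
    then show False using \<open>p \<noteq> x\<close> p pq low by (auto simp: between_vertical_bonds_def)
  qed
  have "q = x + int t"
  proof (rule ccontr)
    assume "q \<noteq> x + int t"
    then have "between_vertical_bonds A (x + int t, y)"
      using p q pq low by (intro between_if_single[of "hbond (x + int t - 1) y"]) (auto simp: line)
    then show False using \<open>q \<noteq> x + int t\<close> q pq low by (auto simp: between_vertical_bonds_def)
  qed
  have t: "t \<ge> 1" using pq(1) \<open>p = x\<close> \<open>q = x + int t\<close> by auto
  obtain U where U: "valid_upper t U" "{e \<in> A. snd (snd e) > y} = upper_bonds x y t U"
    using upper_exists[OF t, of y x] pq(2) \<open>p = x\<close> \<open>q = x + int t\<close> by (auto simp: y_def)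
  have "e \<in> A \<longleftrightarrow> e \<in> hseg y x (x + int t) \<or> e \<in> {e \<in> A. snd (snd e) > y}" for e
  proof (cases "e \<in> horizontal_bonds \<union> vertical_bonds")
    case True
    then show ?thesis
    proof (cases rule: bond_cases)
      case (1 u v)
      then show ?thesis using line[of u] bond_height_ge[of e] by (cases "v = y") (auto simp: y_def)
    next
      case (2 u v)
      then show ?thesis using bond_height_ge[of e] by (auto simp: y_def)
    qed
  next
    case False
    then show ?thesis using bonds hseg_horizontal by blast
  qed
  then have "A = code_animal x y t U" unfolding U(2) code_animal_def by blast
  then show ?thesis using t U(1) unfolding x_def y_def by blast
qed

end

lemma primitive_imp_code:
  assumes "primitive_two_directed A" "A \<inter> vertical_bonds \<noteq> {}"
  obtains x y d U where "d \<ge> 1" "valid_upper d U" "A = code_animal x y d U"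
proof -
  obtain r where r: "\<forall>(u, v)\<in>A. (r, u) \<in> A\<^sup>*"
    using assms(1) by (auto simp: primitive_two_directed_def two_directed_animal_def directed_animal_def)
  interpret rooted_animal A r
  proof
    show "(r, fst e) \<in> A\<^sup>*" if "e \<in> A" for e using r that by (cases e) auto
  qed (use assms(1) in \<open>auto simp: primitive_two_directed_def two_directed_animal_def
      directed_animal_def bond_animal_def\<close>)
  show ?thesis using code_exists[OF assms(2)] that by blast
qed

lemma card_code_animal:
  assumes "d \<ge> 1" "valid_upper d U"
  shows "card (code_animal x y d U \<inter> vertical_bonds) = 2 * Suc (upper_height U)"
    and "card (code_animal x y d U \<inter> horizontal_bonds) = d + upper_weight d U"
proof -
  have "code_animal x y d U \<inter> vertical_bonds = upper_bonds x y d U \<inter> vertical_bonds"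
    by (auto simp: code_animal_def hseg_def)
  then show "card (code_animal x y d U \<inter> vertical_bonds) = 2 * Suc (upper_height U)"
    using card_upper_bonds_vertical[OF assms] by simp
  have "code_animal x y d U \<inter> horizontal_bonds =
      hseg y x (x + int d) \<union> (upper_bonds x y d U \<inter> horizontal_bonds)"
    by (auto simp: code_animal_def dest: hseg_horizontal)
  moreover have "hseg y x (x + int d) \<inter> (upper_bonds x y d U \<inter> horizontal_bonds) = {}"
    by (fastforce dest: hseg_height upper_bonds_height)
  ultimately show "card (code_animal x y d U \<inter> horizontal_bonds) = d + upper_weight d U"
    using card_upper_bonds_horizontal[OF assms(2)] finite_upper_bonds
    by (simp add: card_Un_disjoint)
qed

lemma primitive_animals_eq_codes:
  "primitive_animals (Suc m) k = (\<lambda>(d, U). translation_class (code_animal 0 0 d U)) ` animal_codes m k"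
  (is "?L = ?R")
proof (intro equalityI subsetI)
  fix C assume "C \<in> ?L"
  then obtain A where A: "C = translation_class A" "primitive_two_directed A"
    "card (A \<inter> vertical_bonds) = 2 * Suc m" "card (A \<inter> horizontal_bonds) = k"
    by (auto simp: primitive_animals_def)
  then have "A \<inter> vertical_bonds \<noteq> {}" by force
  then obtain x y d U where code: "d \<ge> 1" "valid_upper d U" "A = code_animal x y d U"
    by (rule primitive_imp_code[OF A(2)])
  have "A = translate (x, y) (code_animal 0 0 d U)"
    by (simp add: translate_code_animal code(3))
  then have "C = translation_class (code_animal 0 0 d U)"
    unfolding A(1) by (simp only: translation_class_translate)
  moreover have "(d, U) \<in> animal_codes m k"
    using A(3,4) code card_code_animal[OF code(1,2)] by (auto simp: animal_codes_def)
  ultimately show "C \<in> ?R" by (intro image_eqI[of _ _ "(d, U)"]) simp_all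
next
  fix C assume "C \<in> ?R"
  then obtain d U where C: "C = translation_class (code_animal 0 0 d U)"
    and "(d, U) \<in> animal_codes m k" by auto
  then have "d \<ge> 1" "valid_upper d U" "upper_height U = m" "d + upper_weight d U = k"
    by (auto simp: animal_codes_def)
  with card_code_animal[of d U 0 0] code_animal_primitive[of d U 0 0]
  show "C \<in> ?L" unfolding C primitive_animals_def by (intro imageI) simp
qed

lemma inj_on_animal_codes: "inj_on (\<lambda>(d, U). translation_class (code_animal 0 0 d U)) (animal_codes m k)"
proof -
  have "d = d' \<and> U = U'" if "(d, U) \<in> animal_codes m k" "(d', U') \<in> animal_codes m k"
    "translation_class (code_animal 0 0 d U) = translation_class (code_animal 0 0 d' U')" for d U d' U'
  proof -
    have "code_animal 0 0 d U = translate (0, 0) (code_animal 0 0 d U)"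
      by (simp add: translate_code_animal)
    then have "code_animal 0 0 d U \<in> translation_class (code_animal 0 0 d U)"
      unfolding translation_class_def by (rule range_eqI)
    then have "code_animal 0 0 d U \<in> translation_class (code_animal 0 0 d' U')"
      unfolding that(3) .
    then obtain s t where "code_animal 0 0 d U = translate (s, t) (code_animal 0 0 d' U')"
      by (auto simp: translation_class_def translate_code_animal)
    then have "code_animal 0 0 d U = code_animal s t d' U'" by (simp add: translate_code_animal)
    then show ?thesis using that(1,2) by (intro code_animal_inj) (auto simp: animal_codes_def)
  qed
  then show ?thesis by (auto simp: inj_on_def)
qed

lemma primitive_gf_eq: "primitive_gf (Suc m) = tail_sum (upper_gf m) 0"
  by (rule fps_ext)
    (simp add: primitive_gf_def primitive_animals_eq_codes card_image[OF inj_on_animal_codes]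
      tail_sum_upper_gf_nth)

theorem mainTheorem11:
  fixes n :: nat and z :: complex
  assumes "n \<ge> 1" and "poly (cyclotomic (n + 1)) z = 0"
  shows "fps_simple_pole (primitive_gf n) z"
proof -
  obtain m where "n = Suc m" using assms(1) by (cases n) auto
  then show ?thesis using simple_pole_upper_gf[of m z] assms(2) by (simp add: primitive_gf_eq)
qed

end
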